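(* There are absolute constants $\varepsilon_0>0$ and $c>0$ such that the following holds. Let $n\le t/100$ and $p\in(0,1]$. Any $k$-pass streaming algorithm $\mathsf{M}$ using $s$ bits of memory that distinguishes $\boldsymbol D_0$ from $\boldsymbol D_1$ with high probability (error rate $\Pr[\mathsf{M}(\boldsymbol D_0)=1]+\Pr[\mathsf{M}(\boldsymbol D_1)=0]\le\varepsilon_0$) satisfies $k\,s\,p^2 n\ge c$.
   Context: Needle problem with domain $[t]$ and stream length $n$. Uniform distribution $\boldsymbol D_0$: $X_1,\dots,X_n$ are i.i.d. uniform on $[t]$. Needle distribution $\boldsymbol D_1$ (with needle probability $p$): first pick $\alpha$ uniformly from $[t]$; then independently for each $i$, $X_i=\alpha$ with probability $p$ and otherwise $X_i$ is uniform on $[t]$. A $k$-pass streaming algorithm reads $X_1,\dots,X_n$ in order $k$ times, may use private randomness, and outputs a bit. *)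

theory Defs
  imports "HOL-Probability.Probability"
begin

definition unif :: "nat \<Rightarrow> nat pmf" where
  "unif t = pmf_of_set {0..<t}"

fun iid_list :: "nat \<Rightarrow> 'a pmf \<Rightarrow> 'a list pmf" where
  "iid_list 0 d = return_pmf []"
| "iid_list (Suc m) d = bind_pmf d (\<lambda>x. bind_pmf (iid_list m d) (\<lambda>xs. return_pmf (x # xs)))"

definition D0 :: "nat \<Rightarrow> nat \<Rightarrow> nat list pmf" where
  "D0 t n = iid_list n (unif t)"

definition D1 :: "nat \<Rightarrow> nat \<Rightarrow> real \<Rightarrow> nat list pmf" where
  "D1 t n p = bind_pmf (unif t) (\<lambda>\<alpha>.
      iid_list n (bind_pmf (bernoulli_pmf p) (\<lambda>b. if b then return_pmf \<alpha> else unif t)))"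

text \<open>A randomized streaming algorithm: memory states are numbers below 2^s
  (i.e. s bits), initial state sigma0, transition delta j i sigma x (pass j,
  position i, current state, current symbol) returning a distribution over the
  new state (private randomness), and a randomized output map on the final state.\<close>

fun run_pass :: "(nat \<Rightarrow> nat \<Rightarrow> nat \<Rightarrow> nat \<Rightarrow> nat pmf) \<Rightarrow> nat \<Rightarrow> nat \<Rightarrow> nat list \<Rightarrow> nat \<Rightarrow> nat pmf" where
  "run_pass \<delta> j i [] \<sigma> = return_pmf \<sigma>"
| "run_pass \<delta> j i (x # xs) \<sigma> = bind_pmf (\<delta> j i \<sigma> x) (\<lambda>\<sigma>'. run_pass \<delta> j (Suc i) xs \<sigma>')"

fun run_passes :: "(nat \<Rightarrow> nat \<Rightarrow> nat \<Rightarrow> nat \<Rightarrow> nat pmf) \<Rightarrow> nat list \<Rightarrow> nat \<Rightarrow> nat \<Rightarrow> nat pmf" where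
  "run_passes \<delta> xs 0 \<sigma> = return_pmf \<sigma>"
| "run_passes \<delta> xs (Suc m) \<sigma> = bind_pmf (run_passes \<delta> xs m \<sigma>) (\<lambda>\<sigma>'. run_pass \<delta> m 0 xs \<sigma>')"

definition run_alg :: "nat \<Rightarrow> nat \<Rightarrow> (nat \<Rightarrow> nat \<Rightarrow> nat \<Rightarrow> nat \<Rightarrow> nat pmf) \<Rightarrow> (nat \<Rightarrow> bool pmf) \<Rightarrow> nat list \<Rightarrow> bool pmf" where
  "run_alg k \<sigma>0 \<delta> out xs = bind_pmf (run_passes \<delta> xs k \<sigma>0) out"

definition uses_s_bits :: "nat \<Rightarrow> nat \<Rightarrow> (nat \<Rightarrow> nat \<Rightarrow> nat \<Rightarrow> nat \<Rightarrow> nat pmf) \<Rightarrow> bool" where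
  "uses_s_bits s \<sigma>0 \<delta> \<longleftrightarrow> \<sigma>0 < 2 ^ s \<and>
     (\<forall>j i \<sigma> x. \<sigma> < 2 ^ s \<longrightarrow> set_pmf (\<delta> j i \<sigma> x) \<subseteq> {..<2 ^ s})"

end

theory Submission
  imports Defs
begin

text \<open>
  Fix the set \<open>S\<close> of needle positions and cut the stream at the midpoints between consecutive needles.
  The transcript consisting of the memory at the cuts in all \<open>k\<close> passes has a product form, one factor
  for each block, so by cut-and-paste the squared Hellinger distance between no needles and all needles is
  at most \<open>e\<^sup>2\<close> times the sum of the distances for each needle alone. Averaged over \<open>\<alpha>\<close>, the distance for a
  needle at \<open>i\<close> is at most the information that the transcript reveals about the symbol at \<open>i\<close>. A block sends
  only \<open>k s\<close> bits, so these informations add up to at most \<open>k s\<close> over all positions \<open>i\<close> of a given block.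
  Since the midpoint cuts make the position of a needle uniform in its block, up to constants, a needle
  costs about \<open>k s p\<close> on average, and the expected \<open>p n\<close> needles cost \<open>O(k s p\<^sup>2 n)\<close>. Sets with at most one
  needle contribute nothing, because a single needle with random \<open>\<alpha>\<close> is a uniform symbol; this removes the
  boundary effects for \<open>p n < 1\<close>.
\<close>

section \<open>Products of kernels\<close>

text \<open>All needles share the symbol \<open>\<alpha>\<close>, so distances are bounded for fixed
  \<open>\<alpha>\<close> and fixed needle positions and averaged afterwards. For this every
  inequality has to be linear in squared distances. The triangle inequality would lose a factor
  equal to the number of needles, while repeated merging loses only a constant; and the passage from
  Hellinger distance to acceptance probabilities pays an additive 1/4 instead of a square root.

  With several passes a block is entered once per pass, and the end of one pass is the start of the
  next. Listing the memory of all passes at one position as a single state turns the transcript into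
  a path weighted by matrices, with an additional weight that couples its two ends. Seen from a
  block, the rest of the stream is not a probability distribution: summed over what enters and what
  leaves the block, its weight is the number of states, because it answers every conceivable
  reaction of the block. This number, \<open>2 ^ (k * s)\<close>, enters the information bound
  through its logarithm.\<close>

primrec kprod :: "'c set \<Rightarrow> (nat \<Rightarrow> 'c \<Rightarrow> 'c \<Rightarrow> real) \<Rightarrow> nat \<Rightarrow> nat \<Rightarrow> 'c \<Rightarrow> 'c \<Rightarrow> real" where
  "kprod C A a 0 = (\<lambda>c d. of_bool (c = d))"
| "kprod C A a (Suc b) = (if a \<le> b then (\<lambda>c d. \<Sum>e\<in>C. kprod C A a b c e * A b e d)
     else (\<lambda>c d. of_bool (c = d)))"

lemma sum_of_bool_eq_left:
  fixes f :: "'c \<Rightarrow> real"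
  assumes "finite C" "c \<in> C"
  shows "(\<Sum>e\<in>C. of_bool (c = e) * f e) = f c"
proof -
  have "(\<Sum>e\<in>C. of_bool (c = e) * f e) = (\<Sum>e\<in>C. if e = c then f e else 0)"
    by (intro sum.cong) auto
  then show ?thesis using assms by simp
qed

lemma sum_of_bool_eq_right:
  fixes f :: "'c \<Rightarrow> real"
  assumes "finite C" "c \<in> C"
  shows "(\<Sum>e\<in>C. f e * of_bool (e = c)) = f c"
proof -
  have "(\<Sum>e\<in>C. f e * of_bool (e = c)) = (\<Sum>e\<in>C. if e = c then f e else 0)"
    by (intro sum.cong) auto
  then show ?thesis using assms by simp
qed

lemma kprod_refl [simp]: "kprod C A a a = (\<lambda>c d. of_bool (c = d))"
  by (cases a) auto

lemma kprod_ge: "b \<le> a \<Longrightarrow> kprod C A a b = (\<lambda>c d. of_bool (c = d))"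
  by (cases b) auto

lemma kprod_Suc: "a \<le> b \<Longrightarrow> kprod C A a (Suc b) c d = (\<Sum>e\<in>C. kprod C A a b c e * A b e d)"
  by simp

lemma kprod_cong:
  assumes "\<And>i. a \<le> i \<Longrightarrow> i < b \<Longrightarrow> A i = A' i"
  shows "kprod C A a b = kprod C A' a b"
  using assms by (induction b) auto

lemma kprod_nonneg:
  assumes "\<And>i c d. a \<le> i \<Longrightarrow> i < b \<Longrightarrow> A i c d \<ge> 0"
  shows "kprod C A a b c d \<ge> 0"
  using assms by (induction b arbitrary: c d) (auto intro!: sum_nonneg)

lemma kprod_append:
  assumes "finite C" "a \<le> b" "b \<le> l" "c \<in> C" "d \<in> C"
  shows "kprod C A a l c d = (\<Sum>e\<in>C. kprod C A a b c e * kprod C A b l e d)"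
  using assms(3,5)
proof (induction l arbitrary: d rule: dec_induct)
  case base
  show ?case using assms base by (simp add: sum_of_bool_eq_right)
next
  case (step l)
  have "kprod C A a (Suc l) c d = (\<Sum>f\<in>C. (\<Sum>e\<in>C. kprod C A a b c e * kprod C A b l e f) * A l f d)"
    using step assms(2) by (simp add: step.IH)
  also have "\<dots> = (\<Sum>f\<in>C. \<Sum>e\<in>C. kprod C A a b c e * (kprod C A b l e f * A l f d))"
    by (simp add: sum_distrib_right mult.assoc)
  also have "\<dots> = (\<Sum>e\<in>C. \<Sum>f\<in>C. kprod C A a b c e * (kprod C A b l e f * A l f d))"
    by (rule sum.swap)
  finally show ?case using step by (simp add: sum_distrib_left)
qed

lemma kprod_single:
  assumes "finite C" "c \<in> C"
  shows "kprod C A i (Suc i) c d = A i c d"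
  using assms by (simp add: sum_of_bool_eq_left)

lemma kprod_split_at:
  assumes "finite C" "a \<le> i" "i < b" "c \<in> C" "d \<in> C"
  shows "kprod C A a b c d =
    (\<Sum>e\<in>C. \<Sum>f\<in>C. kprod C A a i c e * A i e f * kprod C A (Suc i) b f d)"
proof -
  have "kprod C A a b c d = (\<Sum>f\<in>C. kprod C A a (Suc i) c f * kprod C A (Suc i) b f d)"
    by (rule kprod_append) (use assms in auto)
  also have "\<dots> = (\<Sum>f\<in>C. \<Sum>e\<in>C. kprod C A a i c e * A i e f * kprod C A (Suc i) b f d)"
    using assms by (simp add: sum_distrib_right del: kprod.simps add: kprod_Suc)
  finally show ?thesis by (subst sum.swap) simp
qed

text \<open>Regrouping of a matrix product. Equal consecutive endpoints are allowed and give
  identity factors, so blocks can be indexed by all stream positions and not just by the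
  needles.\<close>

lemma kprod_blocks:
  assumes "finite C" "\<And>l. l < m \<Longrightarrow> \<beta> l \<le> \<beta> (Suc l)" "l \<le> m" "c \<in> C" "d \<in> C"
  shows "kprod C (\<lambda>l. kprod C A (\<beta> l) (\<beta> (Suc l))) l m c d = kprod C A (\<beta> l) (\<beta> m) c d"
  using assms(3,2,5)
proof (induction m arbitrary: d rule: dec_induct)
  case base
  then show ?case by simp
next
  case (step m)
  have le: "\<beta> l \<le> \<beta> m" using step.hyps(1) step.prems(1)
    by (induction m rule: dec_induct) (auto intro: order_trans less_SucI)
  have "kprod C (\<lambda>l. kprod C A (\<beta> l) (\<beta> (Suc l))) l (Suc m) c d
      = (\<Sum>e\<in>C. kprod C A (\<beta> l) (\<beta> m) c e * kprod C A (\<beta> m) (\<beta> (Suc m)) e d)"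
    using step by simp
  also have "\<dots> = kprod C A (\<beta> l) (\<beta> (Suc m)) c d"
    by (rule kprod_append[symmetric]) (use assms step le in auto)
  finally show ?case .
qed

lemma sum_PiE_insert:
  assumes "i \<notin> I"
  shows "(\<Sum>y\<in>PiE (insert i I) X. g y) = (\<Sum>x\<in>X i. \<Sum>y\<in>PiE I X. g (y(i := x)))"
proof -
  have inj: "inj_on (\<lambda>(y, g). g(i := y)) (X i \<times> Pi\<^sub>E I X)"
    using inj_combinator[OF assms, of X] by simp
  show ?thesis
    unfolding PiE_insert_eq sum.reindex[OF inj] sum.cartesian_product
    by (simp add: case_prod_unfold)
qed

text \<open>Summing out the interior points turns weighted paths into a matrix product. The factor
  \<open>g\<close> sees both ends at once because a pass starts in the memory in which the previous
  one ended. It is arbitrary in the induction, where it absorbs the last matrix.\<close>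

lemma sum_paths:
  assumes "finite C"
  shows "(\<Sum>\<omega>\<in>PiE {..m} (\<lambda>_. C). g (\<omega> 0) (\<omega> m) * (\<Prod>l<m. F l (\<omega> l) (\<omega> (Suc l))))
    = (\<Sum>c\<in>C. \<Sum>d\<in>C. g c d * kprod C F 0 m c d)"
proof (induction m arbitrary: g)
  case 0
  have "(\<Sum>\<omega>\<in>PiE {..0::nat} (\<lambda>_. C). g (\<omega> 0) (\<omega> 0)) = (\<Sum>c\<in>C. g c c)"
    using sum_PiE_insert[where i = "0::nat" and I = "{}" and X = "\<lambda>_. C" and g = "\<lambda>\<omega>. g (\<omega> 0) (\<omega> 0)"]
    by simp
  then show ?case using assms
    by (simp add: sum_of_bool_eq_left[of C _ "g _"] mult.commute[of "g _ _"])
next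
  case (Suc m)
  let ?P = "PiE {..m} (\<lambda>_. C)"
  have "(\<Sum>\<omega>\<in>PiE {..Suc m} (\<lambda>_. C). g (\<omega> 0) (\<omega> (Suc m)) * (\<Prod>l<Suc m. F l (\<omega> l) (\<omega> (Suc l))))
    = (\<Sum>d\<in>C. \<Sum>\<omega>\<in>?P. g (\<omega> 0) d * ((\<Prod>l<m. F l (\<omega> l) (\<omega> (Suc l))) * F m (\<omega> m) d))"
    unfolding atMost_Suc by (subst sum_PiE_insert) auto
  also have "\<dots> = (\<Sum>\<omega>\<in>?P. (\<Sum>d\<in>C. g (\<omega> 0) d * F m (\<omega> m) d) * (\<Prod>l<m. F l (\<omega> l) (\<omega> (Suc l))))"
    by (subst sum.swap) (simp add: sum_distrib_right sum_distrib_left mult_ac)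
  also have "\<dots> = (\<Sum>c\<in>C. \<Sum>e\<in>C. (\<Sum>d\<in>C. g c d * F m e d) * kprod C F 0 m c e)"
    by (rule Suc.IH)
  also have "\<dots> = (\<Sum>c\<in>C. \<Sum>e\<in>C. \<Sum>d\<in>C. g c d * (kprod C F 0 m c e * F m e d))"
    by (simp add: sum_distrib_right sum_distrib_left mult_ac)
  also have "\<dots> = (\<Sum>c\<in>C. \<Sum>d\<in>C. \<Sum>e\<in>C. g c d * (kprod C F 0 m c e * F m e d))"
    by (intro sum.cong refl sum.swap)
  finally show ?case by (simp add: sum_distrib_left)
qed

text \<open>A product of averages is the average of the products over independent choices. The
  choices are symbols when \<open>X\<close> is the alphabet, and needle indicators when
  \<open>X\<close> is \<open>UNIV :: bool set\<close>.\<close>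

lemma kprod_multilinear:
  assumes "finite X"
  shows "kprod C (\<lambda>i c d. \<Sum>x\<in>X. \<rho> i x * K i x c d) a b c d
    = (\<Sum>y\<in>PiE {a..<b} (\<lambda>_. X). (\<Prod>i\<in>{a..<b}. \<rho> i (y i)) * kprod C (\<lambda>i. K i (y i)) a b c d)"
proof (induction b arbitrary: d)
  case 0
  then show ?case by simp
next
  case (Suc b)
  show ?case
  proof (cases "a \<le> b")
    case True
    let ?P = "PiE {a..<b} (\<lambda>_. X)"
    have upd: "kprod C (\<lambda>i. K i ((y(b := x)) i)) a b = kprod C (\<lambda>i. K i (y i)) a b" for x y
      by (rule kprod_cong) auto
    have ins: "{a..<Suc b} = insert b {a..<b}" using True by auto
    have pr: "(\<Prod>i\<in>{a..<b}. \<rho> i (if i = b then x else y i)) = (\<Prod>i\<in>{a..<b}. \<rho> i (y i))" for x y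
      by (rule prod.cong) auto
    have "(\<Sum>y\<in>PiE {a..<Suc b} (\<lambda>_. X). (\<Prod>i\<in>{a..<Suc b}. \<rho> i (y i)) * kprod C (\<lambda>i. K i (y i)) a (Suc b) c d)
       = (\<Sum>x\<in>X. \<Sum>y\<in>?P. \<Sum>e\<in>C. (\<rho> b x * (\<Prod>i\<in>{a..<b}. \<rho> i (y i))) * (kprod C (\<lambda>i. K i (y i)) a b c e * K b x e d))"
      unfolding ins using True
      by (subst sum_PiE_insert) (simp_all add: upd[simplified] pr sum_distrib_left)
    also have "\<dots> = (\<Sum>x\<in>X. \<Sum>e\<in>C. \<Sum>y\<in>?P. (\<rho> b x * (\<Prod>i\<in>{a..<b}. \<rho> i (y i))) * (kprod C (\<lambda>i. K i (y i)) a b c e * K b x e d))"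
      by (intro sum.cong refl sum.swap)
    also have "\<dots> = (\<Sum>e\<in>C. \<Sum>x\<in>X. \<Sum>y\<in>?P. (\<rho> b x * (\<Prod>i\<in>{a..<b}. \<rho> i (y i))) * (kprod C (\<lambda>i. K i (y i)) a b c e * K b x e d))"
      by (rule sum.swap)
    also have "\<dots> = (\<Sum>e\<in>C. kprod C (\<lambda>i c d. \<Sum>x\<in>X. \<rho> i x * K i x c d) a b c e * (\<Sum>x\<in>X. \<rho> b x * K b x e d))"
      unfolding Suc.IH sum_product
      by (subst sum.swap) (simp add: mult_ac)
    finally show ?thesis using True by simp
  next
    case False
    then show ?thesis by (simp add: kprod_ge)
  qed
qed

section \<open>Hellinger distance and information\<close>

text \<open>Isolates the affinity, the only term that involves \<open>p\<close> and \<open>q\<close>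
  jointly. It depends on their pointwise product, which is what the cut-and-paste property
  controls.\<close>

lemma hellinger_sq_expand:
  fixes p q :: "'a \<Rightarrow> real"
  assumes "\<And>x. x \<in> \<Omega> \<Longrightarrow> p x \<ge> 0" "\<And>x. x \<in> \<Omega> \<Longrightarrow> q x \<ge> 0"
    and "sum p \<Omega> = 1" "sum q \<Omega> = 1"
  shows "(\<Sum>x\<in>\<Omega>. (sqrt (p x) - sqrt (q x))\<^sup>2) = 2 - 2 * (\<Sum>x\<in>\<Omega>. sqrt (p x * q x))"
proof -
  have "(\<Sum>x\<in>\<Omega>. (sqrt (p x) - sqrt (q x))\<^sup>2) = (\<Sum>x\<in>\<Omega>. p x + q x - 2 * sqrt (p x * q x))"
    using assms by (intro sum.cong refl) (simp add: power2_diff real_sqrt_mult)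
  then show ?thesis using assms by (simp add: sum_subtractf sum.distrib sum_distrib_left)
qed

text \<open>The sum of \<open>2 \<langle>u\<^sub>i, u\<^sub>j\<rangle>\<close> over ordered pairs \<open>i \<noteq> j\<close> is twice the squared norm of the total, minus
  \<open>2 D\<close>; so some pair has \<open>2 \<langle>u\<^sub>i, u\<^sub>j\<rangle> \<ge> - 2 D / (N (N - 1))\<close>.\<close>

lemma exists_merge_pair:
  fixes u :: "'i \<Rightarrow> 'a \<Rightarrow> real"
  assumes "finite I" "finite \<Omega>" "card I = N" "N \<ge> 2"
  defines "D \<equiv> \<Sum>i\<in>I. \<Sum>x\<in>\<Omega>. (u i x)\<^sup>2"
  shows "\<exists>i\<in>I. \<exists>j\<in>I. i \<noteq> j \<and> (\<Sum>x\<in>\<Omega>. (u i x - u j x)\<^sup>2)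
    \<le> (\<Sum>x\<in>\<Omega>. (u i x)\<^sup>2) + (\<Sum>x\<in>\<Omega>. (u j x)\<^sup>2) + 2 / (real N * (real N - 1)) * D"
proof (rule ccontr)
  assume neg: "\<not> ?thesis"
  define e where "e = 2 / (real N * (real N - 1)) * D"
  define ip where "ip i j = (\<Sum>x\<in>\<Omega>. u i x * u j x)" for i j
  have ex: "(\<Sum>x\<in>\<Omega>. (u i x - u j x)\<^sup>2)
      = (\<Sum>x\<in>\<Omega>. (u i x)\<^sup>2) + (\<Sum>x\<in>\<Omega>. (u j x)\<^sup>2) - 2 * ip i j" for i j
    by (simp add: ip_def power2_diff sum_subtractf sum.distrib sum_distrib_left mult_ac)
  have lt: "2 * ip i j < - e" if "i \<in> I" "j \<in> I - {i}" for i j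
  proof -
    have "\<not> ((\<Sum>x\<in>\<Omega>. (u i x - u j x)\<^sup>2)
    \<le> (\<Sum>x\<in>\<Omega>. (u i x)\<^sup>2) + (\<Sum>x\<in>\<Omega>. (u j x)\<^sup>2) + e)"
      using neg that unfolding e_def by auto
    then show ?thesis unfolding ex by linarith
  qed
  have ne: "I \<noteq> {}" using assms(3,4) by auto
  have ne': "I - {i} \<noteq> {}" if "i \<in> I" for i
  proof
    assume "I - {i} = {}"
    then have "card I \<le> card {i}" by (intro card_mono) auto
    then show False using assms(3,4) by simp
  qed
  have "(\<Sum>i\<in>I. \<Sum>j\<in>I - {i}. 2 * ip i j) < (\<Sum>i\<in>I. \<Sum>j\<in>I - {i}. - e)"
    using assms(1) ne ne' lt by (intro sum_strict_mono) auto
  also have "\<dots> = - (real N * (real N - 1) * e)"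
    using assms by (simp add: of_nat_diff)
  also have "\<dots> = - 2 * D" using assms(4) by (simp add: e_def)
  finally have 1: "(\<Sum>i\<in>I. \<Sum>j\<in>I - {i}. ip i j) < - D"
    by (simp flip: sum_distrib_left)
  have "0 \<le> (\<Sum>x\<in>\<Omega>. (\<Sum>i\<in>I. u i x)\<^sup>2)" by (intro sum_nonneg) auto
  also have "\<dots> = (\<Sum>x\<in>\<Omega>. \<Sum>i\<in>I. \<Sum>j\<in>I. u i x * u j x)"
    by (simp add: power2_eq_square sum_product)
  also have "\<dots> = (\<Sum>i\<in>I. \<Sum>x\<in>\<Omega>. \<Sum>j\<in>I. u i x * u j x)" by (rule sum.swap)
  also have "\<dots> = (\<Sum>i\<in>I. \<Sum>j\<in>I. ip i j)"
    unfolding ip_def by (intro sum.cong refl sum.swap)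
  also have "\<dots> = (\<Sum>i\<in>I. ip i i + (\<Sum>j\<in>I - {i}. ip i j))"
    using assms(1) by (intro sum.cong refl sum.remove) auto
  also have "\<dots> = D + (\<Sum>i\<in>I. \<Sum>j\<in>I - {i}. ip i j)"
    by (simp add: sum.distrib D_def ip_def power2_eq_square)
  finally show False using 1 by linarith
qed

text \<open>By the cut-and-paste property, two disjoint sets at squared distance \<open>x\<close> from each other have a
  union at squared distance \<open>x\<close> from the empty set. Merging the pair of the previous lemma increases
  the sum on the right by a factor of at most \<open>1 + 2 / (N (N - 1))\<close>, and these factors have a bounded
  product.\<close>

lemma hellinger_union_le:
  fixes P :: "'i set \<Rightarrow> 'a \<Rightarrow> real"
  assumes "finite \<Omega>"
    and nonneg: "\<And>A x. x \<in> \<Omega> \<Longrightarrow> P A x \<ge> 0"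
    and norm: "\<And>A. sum (P A) \<Omega> = 1"
    and cut_paste: "\<And>A B x. x \<in> \<Omega> \<Longrightarrow> A \<inter> B = {} \<Longrightarrow> P A x * P B x = P {} x * P (A \<union> B) x"
  defines "h \<equiv> \<lambda>A B. \<Sum>x\<in>\<Omega>. (sqrt (P A x) - sqrt (P B x))\<^sup>2"
  assumes "finite \<A>" "disjoint \<A>" "{} \<notin> \<A>" "\<A> \<noteq> {}"
  shows "h {} (\<Union>\<A>) \<le> exp (2 - 2 / real (card \<A>)) * (\<Sum>A\<in>\<A>. h {} A)"
  using assms(6-9)
proof (induction "card \<A>" arbitrary: \<A>)
  case 0
  then show ?case by (metis card_0_eq)
next
  case (Suc m \<A>)
  have h_nonneg: "h A B \<ge> 0" for A B unfolding h_def by (intro sum_nonneg) auto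
  have sym: "h A B = h B A" for A B unfolding h_def by (intro sum.cong refl power2_commute)
  have h_union: "h {} (A \<union> B) = h A B" if "A \<inter> B = {}" for A B
    unfolding h_def
    by (subst (1 2) hellinger_sq_expand) (auto simp: nonneg norm cut_paste[OF _ that] intro!: sum.cong)
  show ?case
  proof (cases "m = 0")
    case True
    then obtain A where "\<A> = {A}" using Suc by (metis One_nat_def card_1_singletonE)
    then show ?thesis by simp
  next
    case False
    define N where "N = Suc m"
    define D where "D = (\<Sum>A\<in>\<A>. h {} A)"
    have N: "card \<A> = N" "N \<ge> 2" using Suc False by (auto simp: N_def)
    obtain A B where AB: "A \<in> \<A>" "B \<in> \<A>" "A \<noteq> B"
      and le: "h A B \<le> h A {} + h B {} + 2 / (real N * (real N - 1)) * (\<Sum>A\<in>\<A>. h A {})"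
      using exists_merge_pair[OF Suc.prems(1) assms(1) N, of "\<lambda>A x. sqrt (P A x) - sqrt (P {} x)"]
      unfolding diff_diff_eq2 diff_add_cancel h_def by blast
    have "(\<Sum>A\<in>\<A>. h A {}) = D" unfolding D_def by (intro sum.cong refl sym)
    then have le: "h A B \<le> h {} A + h {} B + 2 / (real N * (real N - 1)) * D"
      using le sym[of A "{}"] sym[of B "{}"] by simp
    have dis: "Z \<inter> Z' = {}" if "Z \<in> \<A>" "Z' \<in> \<A>" "Z \<noteq> Z'" for Z Z'
        using that Suc.prems(2) by (auto simp: disjoint_def)
    have disj: "A \<inter> B = {}" using AB by (intro dis)
    define \<A>' where "\<A>' = insert (A \<union> B) (\<A> - {A, B})"
    \<comment> \<open>If the union were already a member, it would be disjoint from
      \<open>A\<close>, forcing \<open>A\<close> to be empty. So merging lowers the number of sets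
      by exactly one.\<close>
    have notin: "A \<union> B \<notin> \<A> - {A, B}"
    proof
      assume a: "A \<union> B \<in> \<A> - {A, B}"
      then have "(A \<union> B) \<inter> A = {}" using AB by (intro dis) auto
      then have "A = {}" by auto
      then show False using AB Suc.prems by auto
    qed
    have fin: "finite \<A>'" using Suc.prems by (simp add: \<A>'_def)
    have crd: "card (\<A> - {A, B}) = card \<A> - 2"
      using AB Suc.prems by (subst card_Diff_subset) auto
    then have card': "card \<A>' = m"
      using notin Suc.prems(1) N unfolding \<A>'_def by (simp add: N_def)
    have un: "\<Union>\<A>' = \<Union>\<A>" using AB by (auto simp: \<A>'_def)
    have dj: "disjoint \<A>'"
      unfolding \<A>'_def
    proof (rule disjointI)
      fix X Y assume XY: "X \<in> insert (A \<union> B) (\<A> - {A, B})" "Y \<in> insert (A \<union> B) (\<A> - {A, B})" "X \<noteq> Y"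
      have "Z \<inter> A = {}" "Z \<inter> B = {}" if "Z \<in> \<A> - {A, B}" for Z
        using that AB by (intro dis; auto)+
      then have dis': "Z \<inter> (A \<union> B) = {}" "(A \<union> B) \<inter> Z = {}" if "Z \<in> \<A> - {A, B}" for Z
        using that by auto
      show "X \<inter> Y = {}"
        using XY by (elim insertE) (simp_all only: dis' dis Diff_iff not_False_eq_True)
    qed
    have "{} \<notin> \<A>'" using Suc.prems AB by (auto simp: \<A>'_def)
    then have IH: "h {} (\<Union>\<A>) \<le> exp (2 - 2 / real m) * (\<Sum>A\<in>\<A>'. h {} A)"
      using Suc.hyps(1)[of \<A>'] fin card' dj un by (auto simp: \<A>'_def)
    have "D = h {} A + h {} B + (\<Sum>A\<in>\<A> - {A, B}. h {} A)"
    proof -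
      have "\<A> = insert A (insert B (\<A> - {A, B}))" using AB by auto
      then have "D = (\<Sum>A\<in>insert A (insert B (\<A> - {A, B})). h {} A)" unfolding D_def by metis
      then show ?thesis using AB Suc.prems(1) by simp
    qed
    then have "(\<Sum>A\<in>\<A>'. h {} A) \<le> (1 + 2 / (real N * (real N - 1))) * D"
      using notin Suc.prems(1) le h_union[OF disj] by (simp add: \<A>'_def algebra_simps)
    also have "\<dots> \<le> exp (2 / (real N * (real N - 1))) * D"
      by (intro mult_right_mono) (auto simp: D_def h_nonneg sum_nonneg add.commute exp_ge_add_one_self)
    finally have "h {} (\<Union>\<A>) \<le> exp (2 - 2 / real m) * (exp (2 / (real N * (real N - 1))) * D)"
      using IH by (meson exp_ge_zero mult_left_mono order_trans)
    also have "\<dots> = exp ((2 - 2 / real m) + 2 / (real N * (real N - 1))) * D"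
      by (simp only: exp_add mult.assoc)
    finally have "h {} (\<Union>\<A>) \<le> exp ((2 - 2 / real m) + 2 / (real N * (real N - 1))) * D" .
    \<comment> \<open>\<open>2 / (N * (N - 1))\<close> equals \<open>2 / (N - 1) - 2 / N\<close>, so
      the exponents telescope, starting from 0 for a single set.\<close>
    moreover have "(2 - 2 / real m) + 2 / (real N * (real N - 1)) = 2 - 2 / real N"
      using False by (simp add: N_def divide_simps) (simp add: algebra_simps)?
    ultimately show ?thesis using N(1) by (simp only: D_def)
  qed
qed

text \<open>Think of \<open>f y \<tau>\<close> as the probability that a party holding \<open>y\<close> plays its part in the transcript
  \<open>\<tau>\<close>, and of \<open>H \<tau>\<close> as that of the other parties. The bound is Gibbs' inequality for the joint law of
  \<open>y\<close> and \<open>\<tau>\<close> against \<open>A y \<tau> * u * H \<tau> / \<Lambda>\<close>, where \<open>A\<close> is the product of the density ratios of the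
  coordinates.\<close>

lemma information_bound:
  fixes f :: "('i \<Rightarrow> 'x) \<Rightarrow> 'a \<Rightarrow> real" and H :: "'a \<Rightarrow> real"
  assumes fin: "finite I" "finite X" "X \<noteq> {}" "finite \<Omega>"
    and f: "\<And>y \<tau>. y \<in> PiE I (\<lambda>_. X) \<Longrightarrow> \<tau> \<in> \<Omega> \<Longrightarrow> 0 \<le> f y \<tau> \<and> f y \<tau> \<le> 1"
    and norm: "\<And>y. y \<in> PiE I (\<lambda>_. X) \<Longrightarrow> (\<Sum>\<tau>\<in>\<Omega>. H \<tau> * f y \<tau>) = 1"
    and H: "\<And>\<tau>. \<tau> \<in> \<Omega> \<Longrightarrow> H \<tau> \<ge> 0" "sum H \<Omega> = \<Lambda>" "\<Lambda> > 0"
  defines "u \<equiv> (1 / real (card X)) ^ card I"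
  defines "F0 \<equiv> \<lambda>\<tau>. \<Sum>y\<in>PiE I (\<lambda>_. X). u * f y \<tau>"
  defines "F \<equiv> \<lambda>i \<alpha> \<tau>. \<Sum>y\<in>PiE I (\<lambda>_. X). (real (card X) * u * of_bool (y i = \<alpha>)) * f y \<tau>"
  shows "(\<Sum>i\<in>I. \<Sum>\<alpha>\<in>X. (1 / real (card X)) * (\<Sum>\<tau>\<in>\<Omega>. H \<tau> * (sqrt (F0 \<tau>) - sqrt (F i \<alpha> \<tau>))\<^sup>2)) \<le> ln \<Lambda>"
proof -
  define Y where "Y = PiE I (\<lambda>_. X)"
  define T where "T = real (card X)"
  define A where "A y \<tau> = (\<Prod>i\<in>I. F i (y i) \<tau> / F0 \<tau>)" for y \<tau>
  have T: "T > 0" using fin by (simp add: T_def card_gt_0_iff)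
  have u: "u > 0" using T by (simp add: u_def T_def)
  have finY: "finite Y" using fin by (auto simp: Y_def intro: finite_PiE)
  have yX: "y i \<in> X" if "y \<in> Y" "i \<in> I" for y i using that by (auto simp: Y_def PiE_def)
  have f0: "0 \<le> f y \<tau>" and f1: "f y \<tau> \<le> 1" if "y \<in> Y" "\<tau> \<in> \<Omega>" for y \<tau>
    using f that by (auto simp: Y_def)
  have F0_nonneg: "F0 \<tau> \<ge> 0" and F_nonneg: "F i \<alpha> \<tau> \<ge> 0" if "\<tau> \<in> \<Omega>" for \<tau> i \<alpha>
    unfolding F0_def F_def Y_def[symmetric] using that T u
    by (auto intro!: sum_nonneg mult_nonneg_nonneg f0 simp: T_def)
  have F0_pos: "F0 \<tau> > 0" if "\<tau> \<in> \<Omega>" "y \<in> Y" "f y \<tau> > 0" for \<tau> y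
    unfolding F0_def Y_def[symmetric] using that u finY
    by (intro sum_pos2[of _ y]) (auto intro!: mult_nonneg_nonneg f0)
  have F_pos: "F i (y i) \<tau> > 0" if "\<tau> \<in> \<Omega>" "y \<in> Y" "f y \<tau> > 0" for \<tau> y i
    unfolding F_def Y_def[symmetric] using that u finY T
    by (intro sum_pos2[of _ y]) (auto intro!: mult_nonneg_nonneg f0 simp: T_def)
  \<comment> \<open>Total probability: \<open>F i \<alpha>\<close> is the average of
    \<open>f\<close> conditioned on \<open>y i = \<alpha>\<close>, so averaging over \<alpha>
    restores the average over all \<open>y\<close>, with \<open>g\<close> evaluated at
    \<open>y i\<close>.\<close>
  have marg: "(\<Sum>\<alpha>\<in>X. (1 / T) * (F i \<alpha> \<tau> * g \<alpha>)) = (\<Sum>y\<in>Y. u * f y \<tau> * g (y i))"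
    if "i \<in> I" for i \<tau> and g :: "'x \<Rightarrow> real"
  proof -
    have "(\<Sum>\<alpha>\<in>X. (1 / T) * (F i \<alpha> \<tau> * g \<alpha>))
        = (\<Sum>\<alpha>\<in>X. \<Sum>y\<in>Y. (if y i = \<alpha> then u * f y \<tau> * g \<alpha> else 0))"
      unfolding F_def Y_def[symmetric] T_def[symmetric] sum_distrib_left sum_distrib_right
      using T by (intro sum.cong refl) auto
    also have "\<dots> = (\<Sum>y\<in>Y. \<Sum>\<alpha>\<in>X. (if y i = \<alpha> then u * f y \<tau> * g \<alpha> else 0))"
      by (rule sum.swap)
    also have "\<dots> = (\<Sum>y\<in>Y. u * f y \<tau> * g (y i))"
      using fin yX that by (intro sum.cong refl) (simp add: sum.delta)
    finally show ?thesis .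
  qed
  have F0_zero: "F i \<alpha> \<tau> = 0" if "\<tau> \<in> \<Omega>" "F0 \<tau> = 0" for i \<alpha> \<tau>
  proof -
    have "f y \<tau> = 0" if "y \<in> Y" for y
      using F0_pos[of \<tau> y] f0[of y \<tau>] that \<open>\<tau> \<in> \<Omega>\<close> \<open>F0 \<tau> = 0\<close> by force
    then show ?thesis unfolding F_def Y_def[symmetric] by simp
  qed
  \<comment> \<open>Hellinger distance against relative entropy, pointwise, from
    \<open>ln z \<le> z - 1\<close> at \<open>z = sqrt (F0 \<tau> / F i \<alpha> \<tau>)\<close>.
    The linear terms do not cancel for a single \<alpha>; they do so after averaging over
    \<alpha>.\<close>
  have step1: "(sqrt (F0 \<tau>) - sqrt (F i \<alpha> \<tau>))\<^sup>2
      \<le> F0 \<tau> - F i \<alpha> \<tau> + F i \<alpha> \<tau> * ln (F i \<alpha> \<tau> / F0 \<tau>)" if "\<tau> \<in> \<Omega>" for i \<alpha> \<tau>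
  proof (cases "F i \<alpha> \<tau> = 0")
    case True
    then show ?thesis using F0_nonneg[OF that] by simp
  next
    case False
    define a b where "a = F0 \<tau>" and "b = F i \<alpha> \<tau>"
    have a: "a > 0" and b: "b > 0"
      using False F0_zero[OF that] F0_nonneg[OF that] F_nonneg[OF that]
      by (auto simp: a_def b_def less_eq_real_def)
    have "ln (sqrt (a / b)) \<le> sqrt (a / b) - 1" using a b by (intro ln_le_minus_one) auto
    moreover have "ln (sqrt (a / b)) = - ln (b / a) / 2" using a b by (simp add: ln_sqrt ln_div)
    ultimately have "2 - 2 * sqrt (a / b) \<le> ln (b / a)" by simp
    then have "b * (2 - 2 * sqrt (a / b)) \<le> b * ln (b / a)" using b by (intro mult_left_mono) auto
    moreover have "b * sqrt (a / b) = sqrt (a * b)"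
      using a b by (simp add: real_sqrt_divide real_sqrt_mult field_simps)
    ultimately have "2 * b - 2 * sqrt (a * b) \<le> b * ln (b / a)" by (simp add: algebra_simps)
    then show ?thesis unfolding a_def[symmetric] b_def[symmetric] using a b
      by (simp add: power2_diff real_sqrt_mult)
  qed
  have step2: "(\<Sum>\<alpha>\<in>X. (1 / T) * (sqrt (F0 \<tau>) - sqrt (F i \<alpha> \<tau>))\<^sup>2)
      \<le> (\<Sum>y\<in>Y. u * f y \<tau> * ln (F i (y i) \<tau> / F0 \<tau>))" if "\<tau> \<in> \<Omega>" "i \<in> I" for i \<tau>
  proof -
    have "(\<Sum>\<alpha>\<in>X. (1 / T) * (sqrt (F0 \<tau>) - sqrt (F i \<alpha> \<tau>))\<^sup>2)
      \<le> (\<Sum>\<alpha>\<in>X. (1 / T) * (F0 \<tau> - F i \<alpha> \<tau> + F i \<alpha> \<tau> * ln (F i \<alpha> \<tau> / F0 \<tau>)))"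
      using T that by (intro sum_mono mult_left_mono step1) auto
    also have "\<dots> = (\<Sum>\<alpha>\<in>X. (1 / T) * F0 \<tau>) - (\<Sum>\<alpha>\<in>X. (1 / T) * (F i \<alpha> \<tau> * 1))
        + (\<Sum>\<alpha>\<in>X. (1 / T) * (F i \<alpha> \<tau> * ln (F i \<alpha> \<tau> / F0 \<tau>)))"
      by (simp add: sum.distrib sum_subtractf distrib_left right_diff_distrib)
    also have "(\<Sum>\<alpha>\<in>X. (1 / T) * F0 \<tau>) = F0 \<tau>" using T by (simp add: T_def)
    also have "(\<Sum>\<alpha>\<in>X. (1 / T) * (F i \<alpha> \<tau> * 1)) = F0 \<tau>"
      unfolding marg[OF that(2)] F0_def Y_def by simp
    finally show ?thesis unfolding marg[OF that(2)] by simp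
  qed
  have step3: "f y \<tau> * (\<Sum>i\<in>I. ln (F i (y i) \<tau> / F0 \<tau>)) \<le> A y \<tau> / \<Lambda> - f y \<tau> + f y \<tau> * ln \<Lambda>"
    if "y \<in> Y" "\<tau> \<in> \<Omega>" for y \<tau>
  proof (cases "f y \<tau> = 0")
    case True
    have "A y \<tau> \<ge> 0" unfolding A_def using that F_nonneg F0_nonneg
      by (intro prod_nonneg) auto
    then show ?thesis using True H by simp
  next
    case False
    then have fp: "f y \<tau> > 0" using f0[OF that] by simp
    have Ap: "A y \<tau> > 0" unfolding A_def using F_pos F0_pos that fp by (intro prod_pos) auto
    have "(\<Sum>i\<in>I. ln (F i (y i) \<tau> / F0 \<tau>)) = ln (A y \<tau>)"
      unfolding A_def using fin(1) F_pos[OF that(2,1) fp] F0_pos[OF that(2,1) fp]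
      by (intro ln_prod[symmetric]) (auto simp: less_le)
    also have "\<dots> = ln (A y \<tau> / \<Lambda>) + ln \<Lambda>" using Ap H by (simp add: ln_div)
    also have "\<dots> \<le> A y \<tau> / \<Lambda> - 1 + ln \<Lambda>"
      using Ap H ln_le_minus_one[of "A y \<tau> / \<Lambda>"] by simp
    finally have "f y \<tau> * (\<Sum>i\<in>I. ln (F i (y i) \<tau> / F0 \<tau>)) \<le> f y \<tau> * (A y \<tau> / \<Lambda> - 1 + ln \<Lambda>)"
      using fp by (intro mult_left_mono) auto
    also have "\<dots> = f y \<tau> * (A y \<tau> / \<Lambda>) - f y \<tau> + f y \<tau> * ln \<Lambda>" by (simp add: algebra_simps)
    \<comment> \<open>Dropping the factor \<open>f y \<tau>\<close>, which is at most 1, leaves a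
      term whose sum over \<open>y\<close> factorizes over the coordinates.\<close>
    also have "f y \<tau> * (A y \<tau> / \<Lambda>) \<le> 1 * (A y \<tau> / \<Lambda>)"
      using f1[OF that] Ap H by (intro mult_right_mono) auto
    finally show ?thesis by simp
  qed
  have uA: "(\<Sum>y\<in>Y. u * A y \<tau>) \<le> 1" if "\<tau> \<in> \<Omega>" for \<tau>
  proof -
    have "(\<Sum>y\<in>Y. u * A y \<tau>) = (\<Sum>y\<in>Y. \<Prod>i\<in>I. (1 / T) * (F i (y i) \<tau> / F0 \<tau>))"
      unfolding prod.distrib by (simp add: A_def u_def T_def)
    also have "\<dots> = (\<Prod>i\<in>I. \<Sum>\<alpha>\<in>X. (1 / T) * (F i \<alpha> \<tau> / F0 \<tau>))"
      unfolding Y_def using fin by (subst prod_sum_PiE) auto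
    also have "\<dots> \<le> (\<Prod>i\<in>I. 1)"
    proof (intro prod_mono conjI)
      fix i assume i: "i \<in> I"
      show "(\<Sum>\<alpha>\<in>X. (1 / T) * (F i \<alpha> \<tau> / F0 \<tau>)) \<ge> 0"
        using T that F_nonneg F0_nonneg by (intro sum_nonneg) auto
      have "(\<Sum>\<alpha>\<in>X. (1 / T) * (F i \<alpha> \<tau> / F0 \<tau>)) = (\<Sum>\<alpha>\<in>X. (1 / T) * (F i \<alpha> \<tau> * (1 / F0 \<tau>)))"
        by simp
      also have "\<dots> = F0 \<tau> * (1 / F0 \<tau>)"
        unfolding marg[OF i] unfolding F0_def Y_def by (simp only: sum_distrib_right)
      \<comment> \<open>Only an inequality, since the left side is 0 where \<open>F0 \<tau>\<close>
        vanishes.\<close>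
      also have "\<dots> \<le> 1" by simp
      finally show "(\<Sum>\<alpha>\<in>X. (1 / T) * (F i \<alpha> \<tau> / F0 \<tau>)) \<le> 1" .
    qed
    finally show ?thesis by simp
  qed
  \<comment> \<open>Weighted by \<open>H\<close>, whose mass is \<open>\<Lambda>\<close>, the term
    \<open>1 / \<Lambda>\<close> sums to 1 and cancels the total probability of \<open>F0\<close>;
    only \<open>ln \<Lambda>\<close> is left.\<close>
  have step4: "(\<Sum>i\<in>I. \<Sum>\<alpha>\<in>X. (1 / T) * (sqrt (F0 \<tau>) - sqrt (F i \<alpha> \<tau>))\<^sup>2)
     \<le> 1 / \<Lambda> - F0 \<tau> + F0 \<tau> * ln \<Lambda>" if "\<tau> \<in> \<Omega>" for \<tau>
  proof -
    have "(\<Sum>i\<in>I. \<Sum>\<alpha>\<in>X. (1 / T) * (sqrt (F0 \<tau>) - sqrt (F i \<alpha> \<tau>))\<^sup>2)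
       \<le> (\<Sum>i\<in>I. \<Sum>y\<in>Y. u * f y \<tau> * ln (F i (y i) \<tau> / F0 \<tau>))"
      using that by (intro sum_mono step2)
    also have "\<dots> = (\<Sum>y\<in>Y. u * (f y \<tau> * (\<Sum>i\<in>I. ln (F i (y i) \<tau> / F0 \<tau>))))"
      by (subst sum.swap) (simp add: sum_distrib_left mult.assoc)
    also have "\<dots> \<le> (\<Sum>y\<in>Y. u * (A y \<tau> / \<Lambda> - f y \<tau> + f y \<tau> * ln \<Lambda>))"
      using u that by (intro sum_mono mult_left_mono step3) auto
    also have "\<dots> = (\<Sum>y\<in>Y. u * A y \<tau>) / \<Lambda> - F0 \<tau> + F0 \<tau> * ln \<Lambda>"
      unfolding F0_def Y_def[symmetric] sum_distrib_right sum_divide_distrib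
      by (simp add: sum.distrib sum_subtractf algebra_simps)
    also have "(\<Sum>y\<in>Y. u * A y \<tau>) / \<Lambda> \<le> 1 / \<Lambda>"
      using uA[OF that] H by (intro divide_right_mono) auto
    finally show ?thesis by simp
  qed
  have HF0: "(\<Sum>\<tau>\<in>\<Omega>. H \<tau> * F0 \<tau>) = 1"
  proof -
    have "(\<Sum>\<tau>\<in>\<Omega>. H \<tau> * F0 \<tau>) = (\<Sum>y\<in>Y. u * (\<Sum>\<tau>\<in>\<Omega>. H \<tau> * f y \<tau>))"
      unfolding F0_def Y_def[symmetric] sum_distrib_left by (subst sum.swap) (simp add: mult_ac)
    also have "\<dots> = (\<Sum>y\<in>Y. u)" using norm by (simp add: Y_def)
    also have "\<dots> = 1" using T fin unfolding Y_def u_def T_def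
      by (simp add: card_PiE power_one_over)
    finally show ?thesis .
  qed
  have "(\<Sum>i\<in>I. \<Sum>\<alpha>\<in>X. (1 / T) * (\<Sum>\<tau>\<in>\<Omega>. H \<tau> * (sqrt (F0 \<tau>) - sqrt (F i \<alpha> \<tau>))\<^sup>2))
     = (\<Sum>i\<in>I. \<Sum>\<tau>\<in>\<Omega>. \<Sum>\<alpha>\<in>X. H \<tau> * ((1 / T) * (sqrt (F0 \<tau>) - sqrt (F i \<alpha> \<tau>))\<^sup>2))"
    unfolding sum_distrib_left
    by (intro sum.cong refl, subst sum.swap) (simp add: mult_ac)
  also have "\<dots> = (\<Sum>\<tau>\<in>\<Omega>. H \<tau> * (\<Sum>i\<in>I. \<Sum>\<alpha>\<in>X. (1 / T) * (sqrt (F0 \<tau>) - sqrt (F i \<alpha> \<tau>))\<^sup>2))"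
    by (subst sum.swap) (simp add: sum_distrib_left)
  also have "\<dots> \<le> (\<Sum>\<tau>\<in>\<Omega>. H \<tau> * (1 / \<Lambda> - F0 \<tau> + F0 \<tau> * ln \<Lambda>))"
    using H by (intro sum_mono mult_left_mono step4) auto
  also have "\<dots> = (\<Sum>\<tau>\<in>\<Omega>. H \<tau>) / \<Lambda> - (\<Sum>\<tau>\<in>\<Omega>. H \<tau> * F0 \<tau>) + (\<Sum>\<tau>\<in>\<Omega>. H \<tau> * F0 \<tau>) * ln \<Lambda>"
    unfolding sum_distrib_right sum_divide_distrib
    by (simp add: sum.distrib sum_subtractf algebra_simps)
  also have "\<dots> = ln \<Lambda>" using H HF0 by simp
  finally show ?thesis unfolding T_def .
qed

section \<open>Cutting the stream between needles\<close>

text \<open>For a set \<open>y\<close> of needle positions, \<open>cut n y i\<close> is the midpoint (rounded up) between the last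
  needle before \<open>i\<close> and the first needle from \<open>i\<close> on, with value \<open>0\<close> or \<open>n\<close> if one of them is missing. So
  \<open>{cut n y i..<cut n y (Suc i)}\<close> is a block whose only needle is \<open>i\<close> if \<open>y i\<close>, and is empty otherwise.\<close>

definition cut :: "nat \<Rightarrow> (nat \<Rightarrow> bool) \<Rightarrow> nat \<Rightarrow> nat" where
  "cut n y i = (if \<forall>j<i. \<not> y j then 0
     else if \<forall>j. i \<le> j \<and> j < n \<longrightarrow> \<not> y j then n
     else (Max {j. j < i \<and> y j} + Min {j. i \<le> j \<and> j < n \<and> y j} + 1) div 2)"

lemma cut_0 [simp]: "cut n y 0 = 0"
  by (simp add: cut_def)

lemma cut_end:
  assumes "i < n" "y i"
  shows "cut n y n = n"
  using assms by (auto simp: cut_def)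

lemma cut_Suc_eq:
  assumes "\<not> y i"
  shows "cut n y (Suc i) = cut n y i"
proof -
  have 1: "{j. j < Suc i \<and> y j} = {j. j < i \<and> y j}" using assms by (auto simp: less_Suc_eq)
  have 2: "{j. Suc i \<le> j \<and> j < n \<and> y j} = {j. i \<le> j \<and> j < n \<and> y j}"
    using assms by (auto simp: Suc_le_eq le_less)
  have 3: "(\<forall>j<Suc i. \<not> y j) \<longleftrightarrow> (\<forall>j<i. \<not> y j)" using assms by (auto simp: less_Suc_eq)
  have 4: "(\<forall>j. Suc i \<le> j \<and> j < n \<longrightarrow> \<not> y j) \<longleftrightarrow> (\<forall>j. i \<le> j \<and> j < n \<longrightarrow> \<not> y j)"
    using assms by (metis Suc_leD le_antisym not_less_eq_eq)
  show ?thesis unfolding cut_def 1 2 3 4 ..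
qed

text \<open>Once the cut and \<open>i\<close> are known, rounding leaves two candidates for the
  neighbouring needle: \<open>2 * cut n y i - i\<close> and its predecessor. This is the source of
  the factor 2 per neighbour in \<open>block_weight\<close>.\<close>

lemma cut_left:
  assumes "i < n" "y i"
  shows "(cut n y i = 0 \<and> (\<forall>j<i. \<not> y j)) \<or>
    (\<exists>l. l < cut n y i \<and> (l + i = 2 * cut n y i \<or> l + i + 1 = 2 * cut n y i) \<and>
       cut n y i \<le> i \<and> y l \<and> (\<forall>j. l < j \<and> j < i \<longrightarrow> \<not> y j))"
proof (cases "\<forall>j<i. \<not> y j")
  case True
  then show ?thesis by (auto simp: cut_def)
next
  case False
  let ?S = "{j. j < i \<and> y j}"
  define l where "l = Max ?S"
  have "l \<in> ?S" unfolding l_def using False by (intro Max_in) auto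
  then have l: "l < i" "y l" by auto
  have gap: "\<not> y j" if "l < j" "j < i" for j
    using Max_ge[of ?S j] that unfolding l_def[symmetric] by auto
  have "Min {j. i \<le> j \<and> j < n \<and> y j} = i"
    using assms by (intro Min_eqI) auto
  then have "cut n y i = (l + i + 1) div 2" using False assms by (auto simp: cut_def l_def)
  moreover have "l < (l + i + 1) div 2" "(l + i + 1) div 2 \<le> i"
    "l + i = 2 * ((l + i + 1) div 2) \<or> l + i + 1 = 2 * ((l + i + 1) div 2)" using l by presburger+
  ultimately show ?thesis using l gap by (intro disjI2 exI[of _ l]) auto
qed

lemma cut_right:
  assumes "i < n" "y i"
  shows "(cut n y (Suc i) = n \<and> (\<forall>j. i < j \<and> j < n \<longrightarrow> \<not> y j)) \<or>
    (\<exists>r. cut n y (Suc i) \<le> r \<and> (r + i = 2 * cut n y (Suc i) \<or> r + i + 1 = 2 * cut n y (Suc i)) \<and>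
       i < cut n y (Suc i) \<and> r < n \<and> y r \<and> (\<forall>j. i < j \<and> j < r \<longrightarrow> \<not> y j))"
proof (cases "\<forall>j. Suc i \<le> j \<and> j < n \<longrightarrow> \<not> y j")
  case True
  then show ?thesis using assms by (auto simp: cut_def)
next
  case False
  let ?S = "{j. Suc i \<le> j \<and> j < n \<and> y j}"
  define r where "r = Min ?S"
  have "r \<in> ?S" unfolding r_def using False by (intro Min_in) auto
  then have r: "i < r" "r < n" "y r" by auto
  have gap: "\<not> y j" if "i < j" "j < r" for j
    using Min_le[of ?S j] that r(2) unfolding r_def[symmetric] by auto
  have "Max {j. j < Suc i \<and> y j} = i"
    using assms by (intro Max_eqI) auto
  then have "cut n y (Suc i) = (i + r + 1) div 2" using False assms by (auto simp: cut_def r_def)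
  moreover have "i < (i + r + 1) div 2" "(i + r + 1) div 2 \<le> r"
    "r + i = 2 * ((i + r + 1) div 2) \<or> r + i + 1 = 2 * ((i + r + 1) div 2)" using r by presburger+
  ultimately show ?thesis using r gap by (intro disjI2 exI[of _ r]) auto
qed

lemma cut_block:
  assumes "i < n" "y i"
  shows "cut n y i \<le> i" "i < cut n y (Suc i)" "cut n y (Suc i) \<le> n"
    "\<And>j. cut n y i \<le> j \<Longrightarrow> j < cut n y (Suc i) \<Longrightarrow> j \<noteq> i \<Longrightarrow> \<not> y j"
proof -
  show 1: "cut n y i \<le> i" using cut_left[of i n y] assms by auto
  show 2: "i < cut n y (Suc i)" using cut_right[of i n y] assms by auto
  show 3: "cut n y (Suc i) \<le> n" using cut_right[of i n y] assms by auto
  fix j assume j: "cut n y i \<le> j" "j < cut n y (Suc i)" "j \<noteq> i"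
  show "\<not> y j"
  proof (cases "j < i")
    case True
    then show ?thesis using cut_left[of i n y] assms j(1) by (meson less_le_trans)
  next
    case False
    then have "i < j" using j by auto
    then show ?thesis using cut_right[of i n y] assms j(2) 3 by (meson less_le_trans)
  qed
qed

lemma cut_mono_Suc:
  assumes "i < n"
  shows "cut n y i \<le> cut n y (Suc i)"
  using assms cut_block(1,2)[of i n y] cut_Suc_eq[of y i n] by (cases "y i") auto

section \<open>Random needle positions and the law of the block around a needle\<close>

abbreviation bool_vectors :: "nat \<Rightarrow> (nat \<Rightarrow> bool) set" where
  "bool_vectors n \<equiv> PiE {0..<n} (\<lambda>_. UNIV)"

abbreviation bernoulli_weight :: "nat \<Rightarrow> real \<Rightarrow> (nat \<Rightarrow> bool) \<Rightarrow> real" where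
  "bernoulli_weight n p y \<equiv> \<Prod>i\<in>{0..<n}. if y i then p else 1 - p"

lemma bernoulli_weight_event:
  assumes "A \<subseteq> {0..<n}" "Z \<subseteq> {0..<n}" "A \<inter> Z = {}"
  shows "(\<Sum>y\<in>bool_vectors n. bernoulli_weight n p y * of_bool ((\<forall>i\<in>A. y i) \<and> (\<forall>i\<in>Z. \<not> y i)))
    = p ^ card A * (1 - p) ^ card Z"
proof -
  define g where "g i b = (if b then p else 1 - p) * of_bool ((i \<in> A \<longrightarrow> b) \<and> (i \<in> Z \<longrightarrow> \<not> b))" for i b
  have all: "of_bool ((\<forall>i\<in>A. y i) \<and> (\<forall>i\<in>Z. \<not> y i))
      = (\<Prod>i\<in>{0..<n}. of_bool ((i \<in> A \<longrightarrow> y i) \<and> (i \<in> Z \<longrightarrow> \<not> y i)) :: real)" for y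
  proof (cases "(\<forall>i\<in>A. y i) \<and> (\<forall>i\<in>Z. \<not> y i)")
    case False
    then obtain i where "i \<in> {0..<n}" "\<not> ((i \<in> A \<longrightarrow> y i) \<and> (i \<in> Z \<longrightarrow> \<not> y i))"
      using assms by blast
    then have "(\<Prod>i\<in>{0..<n}. of_bool ((i \<in> A \<longrightarrow> y i) \<and> (i \<in> Z \<longrightarrow> \<not> y i)) :: real) = 0"
      by (intro prod_zero) auto
    then show ?thesis using False by simp
  qed simp
  have "(\<Sum>y\<in>bool_vectors n. bernoulli_weight n p y * of_bool ((\<forall>i\<in>A. y i) \<and> (\<forall>i\<in>Z. \<not> y i)))
     = (\<Sum>y\<in>bool_vectors n. \<Prod>i\<in>{0..<n}. g i (y i))"
    unfolding all g_def prod.distrib ..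
  also have "\<dots> = (\<Prod>i\<in>{0..<n}. \<Sum>b\<in>UNIV. g i b)"
    by (subst prod_sum_PiE) auto
  also have "\<dots> = (\<Prod>i\<in>{0..<n}. (if i \<in> A then p else 1) * (if i \<in> Z then 1 - p else 1))"
    using assms(3) by (intro prod.cong refl) (auto simp: g_def UNIV_bool)
  also have "\<dots> = p ^ card A * (1 - p) ^ card Z"
    using assms by (simp add: prod.distrib prod.If_cases Int_absorb1)
  finally show ?thesis .
qed

lemma sum_bernoulli_weight: "(\<Sum>y\<in>bool_vectors n. bernoulli_weight n p y) = 1"
  using bernoulli_weight_event[of "{}" n "{}" p] by simp

text \<open>Union bound over the possible neighbours of a needle. The positions \<open>Z\<close>
  that have to be empty are common to all alternatives, which preserves the factor
  \<open>(1 - p) ^ card Z\<close>.\<close>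

lemma bernoulli_weight_union:
  assumes p: "0 \<le> p" "p \<le> 1"
    and fin: "finite \<O>" and card: "card \<O> \<le> K"
    and sets: "\<And>A. A \<in> \<O> \<Longrightarrow> A \<subseteq> {0..<n} \<and> A \<inter> Z = {} \<and> card A = m" "Z \<subseteq> {0..<n}"
    and ev: "\<And>y. E y \<Longrightarrow> \<exists>A\<in>\<O>. (\<forall>i\<in>A. y i) \<and> (\<forall>i\<in>Z. \<not> y i)"
  shows "(\<Sum>y\<in>bool_vectors n. bernoulli_weight n p y * of_bool (E y)) \<le> real K * p ^ m * (1 - p) ^ card Z"
proof -
  have "(\<Sum>y\<in>bool_vectors n. bernoulli_weight n p y * of_bool (E y))
    \<le> (\<Sum>y\<in>bool_vectors n. bernoulli_weight n p y * (\<Sum>A\<in>\<O>. of_bool ((\<forall>i\<in>A. y i) \<and> (\<forall>i\<in>Z. \<not> y i))))"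
  proof (intro sum_mono mult_left_mono)
    fix y
    show "of_bool (E y) \<le> (\<Sum>A\<in>\<O>. of_bool ((\<forall>i\<in>A. y i) \<and> (\<forall>i\<in>Z. \<not> y i)) :: real)"
    proof (cases "E y")
      case True
      then obtain A where A: "A \<in> \<O>" "(\<forall>i\<in>A. y i) \<and> (\<forall>i\<in>Z. \<not> y i)" using ev by blast
      have "of_bool ((\<forall>i\<in>A. y i) \<and> (\<forall>i\<in>Z. \<not> y i)) \<le> (\<Sum>A\<in>\<O>. of_bool ((\<forall>i\<in>A. y i) \<and> (\<forall>i\<in>Z. \<not> y i)) :: real)"
        by (rule member_le_sum[OF A(1)]) (use fin in auto)
      then show ?thesis using A(2) by simp
    qed (auto intro: sum_nonneg)
  qed (use p in \<open>auto intro!: prod_nonneg\<close>)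
  also have "\<dots> = (\<Sum>A\<in>\<O>. \<Sum>y\<in>bool_vectors n. bernoulli_weight n p y * of_bool ((\<forall>i\<in>A. y i) \<and> (\<forall>i\<in>Z. \<not> y i)))"
    unfolding sum_distrib_left by (rule sum.swap)
  also have "\<dots> = (\<Sum>A\<in>\<O>. p ^ m * (1 - p) ^ card Z)"
    using sets by (intro sum.cong refl) (subst bernoulli_weight_event; simp)
  also have "\<dots> = real (card \<O>) * (p ^ m * (1 - p) ^ card Z)" by simp
  also have "\<dots> \<le> real K * (p ^ m * (1 - p) ^ card Z)"
    using card p by (intro mult_right_mono) auto
  finally show ?thesis by (simp add: mult.assoc)
qed

text \<open>A needle at \<open>i\<close> with block \<open>{a..<b}\<close> has probability about \<open>p * (2 p) * (2 p) * (1 - p) ^ (b - a - 1)\<close>,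
  as there are two possible positions for each neighbouring needle; there is no factor \<open>2 p\<close> on a side
  without neighbour. Midpoints are chosen because this does not depend on \<open>i\<close>.\<close>

definition block_weight :: "nat \<Rightarrow> real \<Rightarrow> nat \<Rightarrow> nat \<Rightarrow> real" where
  "block_weight n p a b = (if a = 0 \<and> b = n then 0
     else if a = 0 \<or> b = n then 2 * p ^ 2 * (1 - p) ^ (b - a - 1)
     else 4 * p ^ 3 * (1 - p) ^ (b - a - 1))"

text \<open>Excludes the event that a needle has the whole stream as its block. That event would add
  the weight \<open>p * (1 - p) ^ (n - 1)\<close>, which is of order \<open>p\<close> and thus
  exceeds \<open>p ^ 2 * n\<close> when \<open>p * n\<close> is small.\<close>

definition several :: "nat \<Rightarrow> (nat \<Rightarrow> bool) \<Rightarrow> bool" where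
  "several n y \<longleftrightarrow> (\<exists>i<n. \<exists>j<n. i \<noteq> j \<and> y i \<and> y j)"

lemma block_probability:
  assumes p: "0 \<le> p" "p \<le> 1" and i: "i < n" "a \<le> i" "i < b" "b \<le> n"
  shows "(\<Sum>y\<in>bool_vectors n. bernoulli_weight n p y *
      of_bool (several n y \<and> y i \<and> cut n y i = a \<and> cut n y (Suc i) = b)) \<le> block_weight n p a b"
    (is "?lhs \<le> _")
proof -
  define Z where "Z = {a..<b} - {i}"
  \<comment> \<open>\<open>L\<close> and \<open>R\<close> hold the candidates for the neighbouring
    needles. They lie outside the block, so \<open>i\<close>, its neighbours and \<open>Z\<close>
    never overlap and the exponents of \<open>p\<close> and \<open>1 - p\<close> are exact.\<close>
  define L where "L = {l. l < a \<and> (l + i = 2 * a \<or> l + i + 1 = 2 * a)}"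
  define R where "R = {r. b \<le> r \<and> r < n \<and> (r + i = 2 * b \<or> r + i + 1 = 2 * b)}"
  have cZ: "card Z = b - a - 1" using i by (simp add: Z_def)
  have Zn: "Z \<subseteq> {0..<n}" using i by (auto simp: Z_def)
  have c2: "finite S \<and> card S \<le> 2" if "S \<subseteq> {x, x'}" for S :: "nat set" and x x'
  proof -
    have "card S \<le> card {x, x'}" using that by (intro card_mono) auto
    also have "\<dots> \<le> 2" by (simp add: card_insert_if)
    finally show ?thesis using that finite_subset by auto
  qed
  have "L \<subseteq> {2 * a - i, 2 * a - i - 1}" by (auto simp: L_def)
  then have L: "finite L" "card L \<le> 2" using c2 by blast+
  have "R \<subseteq> {2 * b - i, 2 * b - i - 1}" by (auto simp: R_def)
  then have R: "finite R" "card R \<le> 2" using c2 by blast+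
  have Zy: "\<forall>j\<in>Z. \<not> y j" if "y i" "cut n y i = a" "cut n y (Suc i) = b" for y
    using cut_block(4)[of i n y] i(1) that by (auto simp: Z_def)
  have left: "\<exists>l\<in>L. y l" if "y i" "cut n y i = a" "a \<noteq> 0" for y
    using cut_left[of i n y] i(1) that by (auto simp: L_def)
  have right: "\<exists>r\<in>R. y r" if "y i" "cut n y (Suc i) = b" "b \<noteq> n" for y
    using cut_right[of i n y] i(1) that by (auto simp: R_def)
  have Lr: "l < n \<and> l \<noteq> i \<and> l \<notin> Z" if "l \<in> L" for l using that i by (auto simp: L_def Z_def)
  have Rr: "r < n \<and> r \<noteq> i \<and> r \<notin> Z" if "r \<in> R" for r using that i by (auto simp: R_def Z_def)
  have LR: "l \<noteq> r" if "l \<in> L" "r \<in> R" for l r using that i by (auto simp: L_def R_def)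
  have iZ: "i \<notin> Z" by (simp add: Z_def)
  consider "a = 0" "b = n" | "a = 0" "b \<noteq> n" | "a \<noteq> 0" "b = n" | "a \<noteq> 0" "b \<noteq> n" by blast
  then show ?thesis
  proof cases
    case 1
    \<comment> \<open>A block that covers the whole stream leaves no place for a second
      needle.\<close>
    have none: "(several n y \<and> y i \<and> cut n y i = a \<and> cut n y (Suc i) = b) = False" for y
    proof (rule iffI)
      assume y: "several n y \<and> y i \<and> cut n y i = a \<and> cut n y (Suc i) = b"
      then obtain j where "j < n" "j \<noteq> i" "y j" unfolding several_def by metis
      then show False using Zy[of y] y 1 by (simp add: Z_def)
    qed simp
    have "?lhs = 0" unfolding none by simp
    then show ?thesis using 1 by (simp add: block_weight_def)
  next
    case 2
    have "?lhs \<le> real 2 * p ^ 2 * (1 - p) ^ card Z"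
    proof (rule bernoulli_weight_union[where \<O> = "(\<lambda>r. {i, r}) ` R"])
      show "card ((\<lambda>r. {i, r}) ` R) \<le> 2" using R card_image_le[of R "\<lambda>r. {i, r}"] by linarith
    next
      fix A assume "A \<in> (\<lambda>r. {i, r}) ` R"
      then obtain r where "r \<in> R" "A = {i, r}" by blast
      then show "A \<subseteq> {0..<n} \<and> A \<inter> Z = {} \<and> card A = 2"
        using Rr[of r] i(1) iZ by simp
    next
      fix y assume y: "several n y \<and> y i \<and> cut n y i = a \<and> cut n y (Suc i) = b"
      obtain r where "r \<in> R" "y r" using right[of y] y 2 by blast
      then show "\<exists>A\<in>(\<lambda>r. {i, r}) ` R. (\<forall>i\<in>A. y i) \<and> (\<forall>i\<in>Z. \<not> y i)"
        using y Zy[of y] by (intro bexI[of _ "{i, r}"]) auto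
    qed (use p R Zn in simp_all)
    then show ?thesis using 2 by (simp add: block_weight_def cZ)
  next
    case 3
    have "?lhs \<le> real 2 * p ^ 2 * (1 - p) ^ card Z"
    proof (rule bernoulli_weight_union[where \<O> = "(\<lambda>r. {i, r}) ` L"])
      show "card ((\<lambda>r. {i, r}) ` L) \<le> 2" using L card_image_le[of L "\<lambda>r. {i, r}"] by linarith
    next
      fix A assume "A \<in> (\<lambda>r. {i, r}) ` L"
      then obtain r where "r \<in> L" "A = {i, r}" by blast
      then show "A \<subseteq> {0..<n} \<and> A \<inter> Z = {} \<and> card A = 2"
        using Lr[of r] i(1) iZ by simp
    next
      fix y assume y: "several n y \<and> y i \<and> cut n y i = a \<and> cut n y (Suc i) = b"
      obtain r where "r \<in> L" "y r" using left[of y] y 3 by blast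
      then show "\<exists>A\<in>(\<lambda>r. {i, r}) ` L. (\<forall>i\<in>A. y i) \<and> (\<forall>i\<in>Z. \<not> y i)"
        using y Zy[of y] by (intro bexI[of _ "{i, r}"]) auto
    qed (use p L Zn in simp_all)
    then show ?thesis using 3 by (simp add: block_weight_def cZ)
  next
    case 4
    have "?lhs \<le> real 4 * p ^ 3 * (1 - p) ^ card Z"
    proof (rule bernoulli_weight_union[where \<O> = "(\<lambda>(l, r). {i, l, r}) ` (L \<times> R)"])
      have "card L * card R \<le> 2 * 2" using L R by (intro mult_le_mono) auto
      then show "card ((\<lambda>(l, r). {i, l, r}) ` (L \<times> R)) \<le> 4"
        using L R card_image_le[of "L \<times> R" "\<lambda>(l, r). {i, l, r}"] by (simp add: card_cartesian_product)
    next
      fix A assume "A \<in> (\<lambda>(l, r). {i, l, r}) ` (L \<times> R)"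
      then obtain l r where lr: "l \<in> L" "r \<in> R" "A = {i, l, r}" by blast
      then show "A \<subseteq> {0..<n} \<and> A \<inter> Z = {} \<and> card A = 3"
        using Lr[of l] Rr[of r] LR[of l r] i(1) iZ by simp
    next
      fix y assume y: "several n y \<and> y i \<and> cut n y i = a \<and> cut n y (Suc i) = b"
      obtain l r where "l \<in> L" "r \<in> R" "y l" "y r" using left[of y] right[of y] y 4 by blast
      then show "\<exists>A\<in>(\<lambda>(l, r). {i, l, r}) ` (L \<times> R). (\<forall>i\<in>A. y i) \<and> (\<forall>i\<in>Z. \<not> y i)"
        using y Zy[of y] by (intro bexI[of _ "{i, l, r}"]) auto
    qed (use p L R Zn in simp_all)
    then show ?thesis using 4 by (simp add: block_weight_def cZ)
  qed
qed

text \<open>For interior blocks one factor \<open>p\<close> is absorbed by the geometric series over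
  the length, which leaves \<open>4 * p ^ 2\<close> for each left endpoint. Blocks touching exactly
  one end of the stream have at most \<open>n\<close> positions for the other endpoint and cost
  \<open>2 * p ^ 2\<close> each, so the constant is 4 + 2 + 2.\<close>

lemma sum_block_weight_le:
  assumes p: "0 < p" "p \<le> 1"
  shows "(\<Sum>a<n. \<Sum>b\<in>{a<..n}. block_weight n p a b) \<le> 8 * p ^ 2 * real n"
proof -
  have geo: "(\<Sum>b\<in>{a<..n}. p * (1 - p) ^ (b - a - 1)) \<le> 1" if "a < n" for a
  proof -
    have "(\<Sum>b\<in>{a<..n}. p * (1 - p) ^ (b - a - 1)) = (\<Sum>d<n - a. p * (1 - p) ^ d)"
      by (rule sum.reindex_bij_witness[of _ "\<lambda>d. d + a + 1" "\<lambda>b. b - a - 1"]) (use that in auto)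
    also have "\<dots> = 1 - (1 - p) ^ (n - a)"
      using one_diff_power_eq[of "1 - p" "n - a"] by (simp add: sum_distrib_left)
    finally show ?thesis using p by simp
  qed
  have pw: "(1 - p) ^ m \<le> 1" "(1 - p) ^ m \<ge> 0" for m using p by (auto intro: power_le_one)
  have bnd: "block_weight n p a b \<le> of_bool (a = 0) * (2 * p ^ 2) + (of_bool (b = n) * (2 * p ^ 2)
      + 4 * p ^ 2 * (p * (1 - p) ^ (b - a - 1)))" if "a < b" "b \<le> n" for a b
  proof -
    define e where "e = (1 - p) ^ (b - a - 1)"
    have e: "0 \<le> e" "e \<le> 1" using pw by (auto simp: e_def)
    have "p ^ 2 * e \<le> p ^ 2 * 1" using e by (intro mult_left_mono) auto
    moreover have "0 \<le> p ^ 2 * (p * e)" using p e by auto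
    moreover have "p ^ 3 * e = p ^ 2 * (p * e)" by (simp add: power2_eq_square power3_eq_cube)
    ultimately show ?thesis unfolding block_weight_def e_def[symmetric] mult.assoc by auto
  qed
  have "(\<Sum>a<n. \<Sum>b\<in>{a<..n}. block_weight n p a b)
     \<le> (\<Sum>a<n. \<Sum>b\<in>{a<..n}. of_bool (a = 0) * (2 * p ^ 2) + (of_bool (b = n) * (2 * p ^ 2)
      + 4 * p ^ 2 * (p * (1 - p) ^ (b - a - 1))))"
    by (intro sum_mono bnd) auto
  also have "\<dots> = (\<Sum>a<n. of_bool (a = 0) * (\<Sum>b\<in>{a<..n}. 2 * p ^ 2)
      + ((\<Sum>b\<in>{a<..n}. of_bool (b = n) * (2 * p ^ 2)) + 4 * p ^ 2 * (\<Sum>b\<in>{a<..n}. p * (1 - p) ^ (b - a - 1))))"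
    by (simp only: sum.distrib sum_distrib_left)
  also have "\<dots> \<le> (\<Sum>a<n. of_bool (a = 0) * (real n * (2 * p ^ 2)) + (2 * p ^ 2 + 4 * p ^ 2 * 1))"
  proof (intro sum_mono add_mono mult_left_mono geo)
    fix a assume a: "a \<in> {..<n}"
    have "(\<Sum>b\<in>{a<..n}. of_bool (b = n) * (2 * p ^ 2)) = (\<Sum>b\<in>{a<..n}. if b = n then 2 * p ^ 2 else 0)"
      by (intro sum.cong) auto
    then show "(\<Sum>b\<in>{a<..n}. of_bool (b = n) * (2 * p ^ 2)) \<le> 2 * p ^ 2" by simp
    show "(\<Sum>b\<in>{a<..n}. 2 * p ^ 2) \<le> real n * (2 * p ^ 2)"
      by (simp add: mult_right_mono)
  qed auto
  also have "\<dots> \<le> 8 * p ^ 2 * real n"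
  proof (cases "n = 0")
    case False
    have "(\<Sum>a<n. of_bool (a = 0) * (real n * (2 * p ^ 2))) = (\<Sum>a<n. if a = 0 then real n * (2 * p ^ 2) else 0)"
      by (intro sum.cong) auto
    then show ?thesis using False by (simp add: sum.distrib)
  qed simp
  finally show ?thesis .
qed

text \<open>The bound on the probability of a block does not depend on where the needle sits inside
  it. So the endpoints can be summed last, and for fixed endpoints the costs of all positions of the
  block add up to at most \<open>\<Lambda>\<close>.\<close>

lemma expected_block_cost:
  fixes J :: "nat \<Rightarrow> nat \<Rightarrow> nat \<Rightarrow> real"
  assumes p: "0 < p" "p \<le> 1"
    and J: "\<And>i a b. J i a b \<ge> 0"
      "\<And>a b. a < b \<Longrightarrow> b \<le> n \<Longrightarrow> (\<Sum>i\<in>{a..<b}. J i a b) \<le> \<Lambda>"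
  shows "(\<Sum>y\<in>bool_vectors n. bernoulli_weight n p y * (of_bool (several n y) *
      (\<Sum>i<n. of_bool (y i) * J i (cut n y i) (cut n y (Suc i))))) \<le> 8 * p ^ 2 * real n * \<Lambda>"
proof -
  define ev where "ev i a b y \<longleftrightarrow> several n y \<and> y i \<and> cut n y i = a \<and> cut n y (Suc i) = b" for i a b y
  define P where "P i = {i. i \<le> n} \<times> {i. i \<le> n} \<inter> {q. fst q \<le> i \<and> i < snd q}" for i :: nat
  have finP: "finite (P i)" for i unfolding P_def by auto
  have bw: "block_weight n p a b \<ge> 0" for a b using p by (auto simp: block_weight_def)
  have w: "bernoulli_weight n p y \<ge> 0" for y using p by (intro prod_nonneg) auto
  have \<Lambda>: "\<Lambda> \<ge> 0" if "n > 0"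
  proof -
    have "0 \<le> (\<Sum>i\<in>{0..<n}. J i 0 n)" using J(1) by (intro sum_nonneg) auto
    then show ?thesis using J(2)[of 0 n] that by linarith
  qed
  have needle_term: "of_bool (several n y) * (of_bool (y i) * J i (cut n y i) (cut n y (Suc i)))
      \<le> (\<Sum>q\<in>P i. of_bool (ev i (fst q) (snd q) y) * J i (fst q) (snd q))" if i: "i < n" for y i
  proof (cases "several n y \<and> y i")
    case True
    let ?q = "(cut n y i, cut n y (Suc i))"
    have q: "?q \<in> P i" using cut_block(1-3)[of i n y] i True by (auto simp: P_def)
    have "of_bool (ev i (fst ?q) (snd ?q) y) * J i (fst ?q) (snd ?q)
        \<le> (\<Sum>q\<in>P i. of_bool (ev i (fst q) (snd q) y) * J i (fst q) (snd q))"
      by (rule member_le_sum[OF q]) (use finP J(1) in auto)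
    then show ?thesis using True by (simp add: ev_def)
  next
    case False
    have "0 \<le> (\<Sum>q\<in>P i. of_bool (ev i (fst q) (snd q) y) * J i (fst q) (snd q))"
      using J(1) by (intro sum_nonneg) auto
    then show ?thesis using False by auto
  qed
  have "(\<Sum>y\<in>bool_vectors n. bernoulli_weight n p y * (of_bool (several n y) *
      (\<Sum>i<n. of_bool (y i) * J i (cut n y i) (cut n y (Suc i)))))
    \<le> (\<Sum>y\<in>bool_vectors n. bernoulli_weight n p y *
        (\<Sum>i<n. \<Sum>q\<in>P i. of_bool (ev i (fst q) (snd q) y) * J i (fst q) (snd q)))"
    unfolding sum_distrib_left[of "of_bool _"]
    by (intro sum_mono mult_left_mono needle_term w) auto
  also have "\<dots> = (\<Sum>i<n. \<Sum>y\<in>bool_vectors n. \<Sum>q\<in>P i.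
      bernoulli_weight n p y * (of_bool (ev i (fst q) (snd q) y) * J i (fst q) (snd q)))"
    unfolding sum_distrib_left by (rule sum.swap)
  also have "\<dots> = (\<Sum>i<n. \<Sum>q\<in>P i. \<Sum>y\<in>bool_vectors n.
      bernoulli_weight n p y * (of_bool (ev i (fst q) (snd q) y) * J i (fst q) (snd q)))"
    by (intro sum.cong refl sum.swap)
  also have "\<dots> = (\<Sum>i<n. \<Sum>q\<in>P i. (\<Sum>y\<in>bool_vectors n.
      bernoulli_weight n p y * of_bool (ev i (fst q) (snd q) y)) * J i (fst q) (snd q))"
    by (simp only: sum_distrib_right mult.assoc)
  also have "\<dots> \<le> (\<Sum>i<n. \<Sum>q\<in>P i. block_weight n p (fst q) (snd q) * J i (fst q) (snd q))"
  proof (intro sum_mono mult_right_mono J(1))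
    fix i q assume "i \<in> {..<n}" "q \<in> P i"
    then show "(\<Sum>y\<in>bool_vectors n. bernoulli_weight n p y * of_bool (ev i (fst q) (snd q) y))
        \<le> block_weight n p (fst q) (snd q)"
      unfolding ev_def using p by (intro block_probability) (auto simp: P_def)
  qed
  also have "\<dots> = (\<Sum>(i, q)\<in>Sigma {..<n} P. block_weight n p (fst q) (snd q) * J i (fst q) (snd q))"
    using finP by (subst sum.Sigma) auto
  also have "\<dots> = (\<Sum>(a, z)\<in>Sigma {..<n} (\<lambda>a. Sigma {a<..n} (\<lambda>b. {a..<b})). block_weight n p a (fst z) * J (snd z) a (fst z))"
    by (rule sum.reindex_bij_witness[of _ "\<lambda>(a, b, i). (i, a, b)" "\<lambda>(i, a, b). (a, b, i)"])
      (auto simp: P_def)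
  also have "\<dots> = (\<Sum>a<n. \<Sum>z\<in>Sigma {a<..n} (\<lambda>b. {a..<b}). block_weight n p a (fst z) * J (snd z) a (fst z))"
    by (subst sum.Sigma) auto
  also have "\<dots> = (\<Sum>a<n. \<Sum>b\<in>{a<..n}. \<Sum>i\<in>{a..<b}. block_weight n p a b * J i a b)"
    by (intro sum.cong refl, subst sum.Sigma) (auto simp: case_prod_unfold)
  also have "\<dots> \<le> (\<Sum>a<n. \<Sum>b\<in>{a<..n}. block_weight n p a b * \<Lambda>)"
    unfolding sum_distrib_left[symmetric] using bw J(2)
    by (intro sum_mono mult_left_mono) auto
  also have "\<dots> = (\<Sum>a<n. \<Sum>b\<in>{a<..n}. block_weight n p a b) * \<Lambda>"
    by (simp add: sum_distrib_right)
  also have "\<dots> \<le> 8 * p ^ 2 * real n * \<Lambda>"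
    using sum_block_weight_le[OF p] \<Lambda> by (cases "n = 0") (auto intro!: mult_right_mono)
  finally show ?thesis .
qed

section \<open>Distance between the streams\<close>

lemma sum_swap4:
  fixes T :: "'c \<Rightarrow> 'c \<Rightarrow> 'c \<Rightarrow> 'c \<Rightarrow> real"
  shows "(\<Sum>e\<in>C. \<Sum>f\<in>C. \<Sum>c\<in>C. \<Sum>d\<in>C. T c d e f) = (\<Sum>c\<in>C. \<Sum>d\<in>C. \<Sum>e\<in>C. \<Sum>f\<in>C. T c d e f)"
proof -
  have "(\<Sum>e\<in>C. \<Sum>f\<in>C. \<Sum>c\<in>C. \<Sum>d\<in>C. T c d e f) = (\<Sum>e\<in>C. \<Sum>c\<in>C. \<Sum>f\<in>C. \<Sum>d\<in>C. T c d e f)"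
    by (rule sum.cong[OF refl], rule sum.swap)
  also have "\<dots> = (\<Sum>c\<in>C. \<Sum>e\<in>C. \<Sum>f\<in>C. \<Sum>d\<in>C. T c d e f)"
    by (rule sum.swap)
  also have "\<dots> = (\<Sum>c\<in>C. \<Sum>e\<in>C. \<Sum>d\<in>C. \<Sum>f\<in>C. T c d e f)"
    by (rule sum.cong[OF refl], rule sum.cong[OF refl], rule sum.swap)
  also have "\<dots> = (\<Sum>c\<in>C. \<Sum>d\<in>C. \<Sum>e\<in>C. \<Sum>f\<in>C. T c d e f)"
    by (rule sum.cong[OF refl], rule sum.swap)
  finally show ?thesis .
qed

text \<open>\<open>C\<close> is the set of memory contents at one position of the stream, \<open>Ker i x\<close> the transition caused by
  the symbol \<open>x\<close> at position \<open>i\<close>, \<open>w\<close> couples the contents at the two ends of the stream. The set \<open>good\<close>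
  consists of matrices that make the stream between the ends a legal randomized computation.\<close>

locale stream_kernels =
  fixes C :: "'c set" and w :: "'c \<Rightarrow> 'c \<Rightarrow> real" and good :: "('c \<Rightarrow> 'c \<Rightarrow> real) \<Rightarrow> bool"
    and n t :: nat and Ker :: "nat \<Rightarrow> nat \<Rightarrow> 'c \<Rightarrow> 'c \<Rightarrow> real"
  assumes finite_C: "finite C" and C_nonempty: "C \<noteq> {}" and t_pos: "t > 0"
    and w_nonneg: "\<And>c d. w c d \<ge> 0"
    and Ker_nonneg: "\<And>i x c d. Ker i x c d \<ge> 0"
    and Ker_row: "\<And>i x c. c \<in> C \<Longrightarrow> (\<Sum>d\<in>C. Ker i x c d) = 1"
    and good_Ker: "\<And>i x. good (Ker i x)"
    and good_Id: "good (\<lambda>c d. of_bool (c = d))"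
    and good_uniform: "good (\<lambda>c d. 1 / real (card C))"
    and good_mult: "\<And>A B. good A \<Longrightarrow> good B \<Longrightarrow> good (\<lambda>c d. \<Sum>e\<in>C. A c e * B e d)"
    and good_affine: "\<And>X \<rho> K. finite X \<Longrightarrow> sum \<rho> X = 1 \<Longrightarrow> (\<And>x. x \<in> X \<Longrightarrow> good (K x))
      \<Longrightarrow> good (\<lambda>c d. \<Sum>x\<in>(X :: nat set). \<rho> x * K x c d)"
    and good_norm: "\<And>A. good A \<Longrightarrow> (\<Sum>c\<in>C. \<Sum>d\<in>C. w c d * A c d) = 1"
begin

text \<open>\<open>base\<close> is a uniformly random symbol, \<open>env a b\<close> the weight of everything outside \<open>{a..<b}\<close>, and
  \<open>cost \<alpha> i a b\<close> the squared Hellinger distance caused by a single needle \<open>\<alpha>\<close> at \<open>i\<close>, as seen from the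
  memory at the ends of \<open>{a..<b}\<close>.\<close>

definition base :: "nat \<Rightarrow> 'c \<Rightarrow> 'c \<Rightarrow> real" where
  "base i = (\<lambda>c d. \<Sum>x<t. 1 / real t * Ker i x c d)"

definition mixed :: "nat \<Rightarrow> (nat \<Rightarrow> bool) \<Rightarrow> nat \<Rightarrow> 'c \<Rightarrow> 'c \<Rightarrow> real" where
  "mixed \<alpha> y i = (if y i then Ker i \<alpha> else base i)"

definition env :: "nat \<Rightarrow> nat \<Rightarrow> 'c \<Rightarrow> 'c \<Rightarrow> real" where
  "env a b e f = (\<Sum>c\<in>C. \<Sum>d\<in>C. w c d * (kprod C base 0 a c e * kprod C base b n f d))"

definition cost :: "nat \<Rightarrow> nat \<Rightarrow> nat \<Rightarrow> nat \<Rightarrow> real" where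
  "cost \<alpha> i a b = (\<Sum>e\<in>C. \<Sum>f\<in>C. env a b e f *
     (sqrt (kprod C base a b e f) - sqrt (kprod C (base(i := Ker i \<alpha>)) a b e f))\<^sup>2)"

lemma good_base: "good (base i)"
  unfolding base_def using t_pos by (intro good_affine good_Ker) auto

lemma good_mixed: "good (mixed \<alpha> y i)"
  by (simp add: mixed_def good_Ker good_base)

lemma good_kprod:
  assumes "\<And>i. good (A i)"
  shows "good (kprod C A a b)"
  using assms by (induction b) (auto intro: good_mult good_Id)

lemma base_nonneg: "base i c d \<ge> 0"
  unfolding base_def by (intro sum_nonneg mult_nonneg_nonneg Ker_nonneg) auto

lemma mixed_nonneg: "mixed \<alpha> y i c d \<ge> 0"
  by (simp add: mixed_def base_nonneg Ker_nonneg)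

lemma env_nonneg: "env a b e f \<ge> 0"
  unfolding env_def
  by (intro sum_nonneg mult_nonneg_nonneg w_nonneg kprod_nonneg base_nonneg)

lemma cost_nonneg: "cost \<alpha> i a b \<ge> 0"
  unfolding cost_def by (intro sum_nonneg mult_nonneg_nonneg env_nonneg) auto

section \<open>Information cost of a single block\<close>

lemma kprod_Ker_row:
  assumes "c \<in> C"
  shows "(\<Sum>d\<in>C. kprod C (\<lambda>i. Ker i (y i)) a b c d) = 1"
proof (induction b)
  case 0
  show ?case using assms finite_C sum_of_bool_eq_left[of C c "\<lambda>_. 1"] by simp
next
  case (Suc b)
  show ?case
  proof (cases "a \<le> b")
    case True
    have "(\<Sum>d\<in>C. kprod C (\<lambda>i. Ker i (y i)) a (Suc b) c d)
       = (\<Sum>e\<in>C. \<Sum>d\<in>C. kprod C (\<lambda>i. Ker i (y i)) a b c e * Ker b (y b) e d)"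
      unfolding kprod_Suc[OF True] by (rule sum.swap)
    also have "\<dots> = (\<Sum>e\<in>C. kprod C (\<lambda>i. Ker i (y i)) a b c e * (\<Sum>d\<in>C. Ker b (y b) e d))"
      by (simp only: sum_distrib_left)
    finally have "(\<Sum>d\<in>C. kprod C (\<lambda>i. Ker i (y i)) a (Suc b) c d) = \<dots>" .
    then show ?thesis using Suc by (simp add: Ker_row del: kprod.simps)
  next
    case False
    then show ?thesis using assms finite_C sum_of_bool_eq_left[of C c "\<lambda>_. 1"] by simp
  qed
qed

lemma kprod_Ker_le_1:
  assumes "c \<in> C" "d \<in> C"
  shows "kprod C (\<lambda>i. Ker i (y i)) a b c d \<le> 1"
proof -
  have "kprod C (\<lambda>i. Ker i (y i)) a b c d \<le> (\<Sum>d\<in>C. kprod C (\<lambda>i. Ker i (y i)) a b c d)"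
    using assms finite_C by (intro member_le_sum kprod_nonneg Ker_nonneg) auto
  then show ?thesis using kprod_Ker_row[OF assms(1)] by simp
qed

text \<open>Inserting \<open>M\<close> between the two outer products gives a legal stream, whose
  total weight is 1. The matrices of interest are an actual block on fixed symbols and the uniform
  matrix, which reveals the mass of \<open>env\<close>.\<close>

lemma sum_env:
  assumes "good M"
  shows "(\<Sum>e\<in>C. \<Sum>f\<in>C. env a b e f * M e f) = 1"
proof -
  let ?L = "kprod C base 0 a" and ?R = "kprod C base b n"
  have "(\<Sum>c\<in>C. \<Sum>d\<in>C. w c d * (\<Sum>f\<in>C. (\<Sum>e\<in>C. ?L c e * M e f) * ?R f d)) = 1"
    by (intro good_norm good_mult good_kprod good_base assms)
  moreover have "(\<Sum>e\<in>C. \<Sum>f\<in>C. env a b e f * M e f)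
     = (\<Sum>e\<in>C. \<Sum>f\<in>C. \<Sum>c\<in>C. \<Sum>d\<in>C. w c d * (?L c e * M e f * ?R f d))"
    unfolding env_def sum_distrib_right by (intro sum.cong refl) (simp add: mult_ac)
  moreover have "\<dots> = (\<Sum>c\<in>C. \<Sum>d\<in>C. \<Sum>e\<in>C. \<Sum>f\<in>C. w c d * (?L c e * M e f * ?R f d))"
    by (rule sum_swap4)
  moreover have "(\<Sum>e\<in>C. \<Sum>f\<in>C. w c d * (?L c e * M e f * ?R f d))
     = w c d * (\<Sum>f\<in>C. (\<Sum>e\<in>C. ?L c e * M e f) * ?R f d)" for c d
    unfolding sum_distrib_right sum_distrib_left by (rule sum.swap)
  ultimately show ?thesis by simp
qed

text \<open>The party of \<open>information_bound\<close> is the block holding its symbols, a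
  transcript is the pair of states at its two ends, and \<open>env\<close> is the weight of the
  others. There are \<open>card C\<close> squared transcripts, but the mass of \<open>env\<close> is
  only \<open>card C\<close>: the incoming states are not sent by the block and are not charged to
  it.\<close>

lemma expected_cost_le:
  assumes "a < b" "b \<le> n"
  shows "(\<Sum>i\<in>{a..<b}. \<Sum>\<alpha><t. 1 / real t * cost \<alpha> i a b) \<le> ln (real (card C))"
proof -
  let ?Y = "PiE {a..<b} (\<lambda>_. {..<t})"
  define u where "u = (1 / real (card {..<t})) ^ card {a..<b}"
  define f where "f y \<tau> = kprod C (\<lambda>i. Ker i (y i)) a b (fst \<tau>) (snd \<tau>)" for y \<tau>
  define H where "H \<tau> = env a b (fst \<tau>) (snd \<tau>)" for \<tau>
  have F0: "(\<Sum>y\<in>?Y. u * f y \<tau>) = kprod C base a b (fst \<tau>) (snd \<tau>)" for \<tau>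
    unfolding base_def f_def u_def
    by (subst kprod_multilinear) (auto simp: power_one_over prod_dividef)
  have F: "(\<Sum>y\<in>?Y. (real (card {..<t}) * u * of_bool (y i = \<alpha>)) * f y \<tau>)
      = kprod C (base(i := Ker i \<alpha>)) a b (fst \<tau>) (snd \<tau>)"
    if i: "i \<in> {a..<b}" and \<alpha>: "\<alpha> < t" for i \<alpha> \<tau>
  proof -
    \<comment> \<open>The uniform weight at \<open>i\<close> is replaced by a point mass. The
      remaining product lacks one factor \<open>1 / t\<close>, which accounts for the factor
      \<open>card {..<t}\<close> in the conditional average.\<close>
    define \<rho> where "\<rho> j x = (if j = i then of_bool (x = \<alpha>) else 1 / real t)" for j x
    have "base(i := Ker i \<alpha>) = (\<lambda>j c d. \<Sum>x<t. \<rho> j x * Ker j x c d)"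
    proof (intro ext)
      fix j c d
      have "(\<Sum>x<t. of_bool (x = \<alpha>) * Ker j x c d) = (\<Sum>x<t. if x = \<alpha> then Ker j x c d else 0)"
        by (intro sum.cong) auto
      then show "(base(i := Ker i \<alpha>)) j c d = (\<Sum>x<t. \<rho> j x * Ker j x c d)"
        using \<alpha> by (auto simp: base_def \<rho>_def)
    qed
    moreover have "(\<Prod>j\<in>{a..<b}. \<rho> j (y j)) = real (card {..<t}) * u * of_bool (y i = \<alpha>)" for y
    proof -
      have "(\<Prod>j\<in>{a..<b}. \<rho> j (y j)) = \<rho> i (y i) * (\<Prod>j\<in>{a..<b} - {i}. \<rho> j (y j))"
        using i by (intro prod.remove) auto
      also have "(\<Prod>j\<in>{a..<b} - {i}. \<rho> j (y j)) = (1 / real t) ^ (b - a - 1)"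
        using i by (simp add: \<rho>_def)
      also have "\<dots> = real t * (1 / real t) ^ (b - a)"
        using t_pos assms(1) by (cases "b - a") auto
      finally show ?thesis by (simp add: \<rho>_def u_def)
    qed
    ultimately show ?thesis unfolding f_def by (simp add: kprod_multilinear)
  qed
  have "(\<Sum>i\<in>{a..<b}. \<Sum>\<alpha><t. (1 / real (card {..<t})) * (\<Sum>\<tau>\<in>C \<times> C. H \<tau> *
      (sqrt (\<Sum>y\<in>?Y. u * f y \<tau>)
        - sqrt (\<Sum>y\<in>?Y. (real (card {..<t}) * u * of_bool (y i = \<alpha>)) * f y \<tau>))\<^sup>2)) \<le> ln (real (card C))"
    unfolding u_def
  proof (rule information_bound)
    show "sum H (C \<times> C) = real (card C)"
    proof -
      \<comment> \<open>a block that ignores its input and writes random memory contents is still a legal computation\<close>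
      have "(\<Sum>e\<in>C. \<Sum>f\<in>C. env a b e f * (1 / real (card C))) = 1"
        by (rule sum_env[OF good_uniform])
      then have "(\<Sum>e\<in>C. \<Sum>f\<in>C. env a b e f) / real (card C) = 1"
        by (simp add: sum_divide_distrib)
      then show ?thesis using finite_C C_nonempty
        by (simp add: H_def sum.cartesian_product case_prod_unfold divide_eq_1_iff)
    qed
    show "(\<Sum>\<tau>\<in>C \<times> C. H \<tau> * f y \<tau>) = 1" for y
      using sum_env[OF good_kprod[OF good_Ker], of a b "\<lambda>i. i" y a b]
      by (simp add: H_def f_def sum.cartesian_product case_prod_unfold)
  qed (use finite_C C_nonempty t_pos in
    \<open>auto simp: f_def H_def card_gt_0_iff intro!: kprod_nonneg Ker_nonneg kprod_Ker_le_1 env_nonneg\<close>)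
  moreover have "(\<Sum>\<tau>\<in>C \<times> C. H \<tau> *
      (sqrt (\<Sum>y\<in>?Y. u * f y \<tau>)
        - sqrt (\<Sum>y\<in>?Y. (real (card {..<t}) * u * of_bool (y i = \<alpha>)) * f y \<tau>))\<^sup>2) = cost \<alpha> i a b"
    if "i \<in> {a..<b}" "\<alpha> < t" for i \<alpha>
    unfolding F0 F[OF that] cost_def H_def by (simp add: sum.cartesian_product case_prod_unfold)
  ultimately show ?thesis by simp
qed

section \<open>From block costs to acceptance probabilities\<close>

definition total :: "('c \<Rightarrow> 'c \<Rightarrow> real) \<Rightarrow> (nat \<Rightarrow> 'c \<Rightarrow> 'c \<Rightarrow> real) \<Rightarrow> real" where
  "total q A = (\<Sum>c\<in>C. \<Sum>d\<in>C. w c d * q c d * kprod C A 0 n c d)"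

lemma mixed_distance:
  assumes i0: "i0 < n" "y i0" and q: "\<And>c d. 0 \<le> q c d" "\<And>c d. q c d \<le> 1"
  shows "\<bar>total q (mixed \<alpha> y) - total q base\<bar>
    \<le> 1 / 4 + 4 * exp 2 * (\<Sum>i<n. of_bool (y i) * cost \<alpha> i (cut n y i) (cut n y (Suc i)))"
proof -
  define \<beta> where "\<beta> = cut n y"
  define F where "F b l = kprod C (if b then mixed \<alpha> y else base) (\<beta> l) (\<beta> (Suc l))" for b l
  \<comment> \<open>Transcript weight when exactly the blocks in \<open>S\<close> receive their
    needles. A factor depends on \<open>S\<close> only through \<open>l \<in> S\<close>, which
    yields the cut-and-paste property; positions without a needle have empty blocks.\<close>
  define P where "P S \<omega> = w (\<omega> 0) (\<omega> n) * (\<Prod>l<n. F (l \<in> S) l (\<omega> l) (\<omega> (Suc l)))" for S \<omega>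
  define \<Omega> where "\<Omega> = PiE {..n} (\<lambda>_. C)"
  define h where "h S = (\<Sum>\<omega>\<in>\<Omega>. (sqrt (P {} \<omega>) - sqrt (P S \<omega>))\<^sup>2)" for S
  have fin\<Omega>: "finite \<Omega>" unfolding \<Omega>_def using finite_C by (intro finite_PiE) auto
  \<comment> \<open>Without any needle every cut would be 0. The needle \<open>i0\<close> guarantees
    that the blocks reach the end of the stream.\<close>
  have \<beta>0: "\<beta> 0 = 0" and \<beta>n: "\<beta> n = n" using i0 by (auto simp: \<beta>_def intro: cut_end)
  have \<beta>_mono: "\<beta> l \<le> \<beta> (Suc l)" if "l < n" for l
    using cut_mono_Suc[OF that] by (simp add: \<beta>_def)
  have F_nonneg: "F b l c d \<ge> 0" for b l c d
    unfolding F_def by (auto intro!: kprod_nonneg mixed_nonneg base_nonneg)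
  have F_good: "good (F b l)" for b l
    unfolding F_def by (intro good_kprod) (auto intro: good_mixed good_base)
  have P_nonneg: "P S \<omega> \<ge> 0" for S \<omega>
    unfolding P_def by (intro mult_nonneg_nonneg prod_nonneg ballI w_nonneg F_nonneg)
  have P_norm: "sum (P S) \<Omega> = 1" for S
  proof -
    have "sum (P S) \<Omega> = (\<Sum>c\<in>C. \<Sum>d\<in>C. w c d * kprod C (\<lambda>l. F (l \<in> S) l) 0 n c d)"
      unfolding P_def \<Omega>_def by (rule sum_paths[OF finite_C, of w])
    also have "\<dots> = 1" by (intro good_norm good_kprod F_good)
    finally show ?thesis .
  qed
  have blocks: "kprod C (F b) 0 n c d = kprod C (if b then mixed \<alpha> y else base) 0 n c d"
    if "c \<in> C" "d \<in> C" for b c d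
    using kprod_blocks[OF finite_C, of n \<beta> 0 c d "if b then mixed \<alpha> y else base"] \<beta>_mono that
    by (simp add: F_def[abs_def] \<beta>0 \<beta>n)
  have tot: "total q (if b then mixed \<alpha> y else base)
      = (\<Sum>\<omega>\<in>\<Omega>. q (\<omega> 0) (\<omega> n) * P (if b then {..<n} else {}) \<omega>)" for b
  proof -
    have "P (if b then {..<n} else {}) \<omega> = w (\<omega> 0) (\<omega> n) * (\<Prod>l<n. F b l (\<omega> l) (\<omega> (Suc l)))" for \<omega>
      unfolding P_def by (intro arg_cong2[of _ _ _ _ "(*)"] prod.cong refl) auto
    then have "(\<Sum>\<omega>\<in>\<Omega>. q (\<omega> 0) (\<omega> n) * P (if b then {..<n} else {}) \<omega>)
        = (\<Sum>\<omega>\<in>\<Omega>. (w (\<omega> 0) (\<omega> n) * q (\<omega> 0) (\<omega> n)) * (\<Prod>l<n. F b l (\<omega> l) (\<omega> (Suc l))))"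
      by (simp add: mult_ac)
    also have "\<dots> = (\<Sum>c\<in>C. \<Sum>d\<in>C. w c d * q c d * kprod C (F b) 0 n c d)"
      unfolding \<Omega>_def by (rule sum_paths[OF finite_C, of "\<lambda>c d. w c d * q c d"])
    also have "\<dots> = total q (if b then mixed \<alpha> y else base)"
      unfolding total_def by (intro sum.cong refl) (simp only: blocks)
    finally show ?thesis ..
  qed
  have single: "h {l} = of_bool (y l) * cost \<alpha> l (\<beta> l) (\<beta> (Suc l))" if l: "l < n" for l
  proof -
    \<comment> \<open>The weights for \<open>{}\<close> and \<open>{l}\<close> differ in one factor
      only, so the square of the difference of their roots is again a product, with that factor
      replaced. Hence it can be summed over paths.\<close>
    define G where "G i = (if i = l then (\<lambda>c d. (sqrt (F False l c d) - sqrt (F True l c d))\<^sup>2) else F False i)" for i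
    have G: "(sqrt (P {} \<omega>) - sqrt (P {l} \<omega>))\<^sup>2 = w (\<omega> 0) (\<omega> n) * (\<Prod>i<n. G i (\<omega> i) (\<omega> (Suc i)))" for \<omega>
    proof -
      define R where "R = w (\<omega> 0) (\<omega> n) * (\<Prod>i\<in>{..<n} - {l}. F False i (\<omega> i) (\<omega> (Suc i)))"
      have rem: "(\<Prod>i<n. g i) = g l * (\<Prod>i\<in>{..<n} - {l}. g i)" for g :: "nat \<Rightarrow> real"
        using l by (intro prod.remove) auto
      have "R \<ge> 0" unfolding R_def by (intro mult_nonneg_nonneg prod_nonneg ballI w_nonneg F_nonneg)
      moreover have "P {} \<omega> = R * F False l (\<omega> l) (\<omega> (Suc l))"
        unfolding P_def rem R_def by simp
      moreover have "P {l} \<omega> = R * F True l (\<omega> l) (\<omega> (Suc l))"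
        unfolding P_def rem R_def by simp
      moreover have "w (\<omega> 0) (\<omega> n) * (\<Prod>i<n. G i (\<omega> i) (\<omega> (Suc i)))
          = R * (sqrt (F False l (\<omega> l) (\<omega> (Suc l))) - sqrt (F True l (\<omega> l) (\<omega> (Suc l))))\<^sup>2"
        unfolding rem R_def by (simp add: G_def)
      ultimately show ?thesis
        by (simp add: real_sqrt_mult right_diff_distrib[symmetric] power_mult_distrib)
    qed
    let ?L = "kprod C base 0 (\<beta> l)" and ?R = "kprod C base (\<beta> (Suc l)) n"
    have split: "kprod C G 0 n c d = (\<Sum>e\<in>C. \<Sum>f\<in>C. ?L c e * G l e f * ?R f d)"
      if "c \<in> C" "d \<in> C" for c d
    proof -
      have "kprod C G 0 l = kprod C (F False) 0 l" "kprod C G (Suc l) n = kprod C (F False) (Suc l) n"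
        by (auto intro!: kprod_cong simp: G_def)
      moreover have "kprod C (F False) 0 l c e = ?L c e" if "e \<in> C" for e
        using kprod_blocks[OF finite_C, of l \<beta> 0 c e base] \<beta>_mono l \<open>c \<in> C\<close> that
        by (simp add: F_def[abs_def] \<beta>0)
      moreover have "kprod C (F False) (Suc l) n f d = ?R f d" if "f \<in> C" for f
        using kprod_blocks[OF finite_C, of n \<beta> "Suc l" f d base] \<beta>_mono l \<open>d \<in> C\<close> that
        by (simp add: F_def[abs_def] \<beta>n)
      ultimately show ?thesis
        unfolding kprod_split_at[OF finite_C le0 l that, of G] by simp
    qed
    have "h {l} = (\<Sum>c\<in>C. \<Sum>d\<in>C. w c d * kprod C G 0 n c d)"
      unfolding h_def G \<Omega>_def by (rule sum_paths[OF finite_C])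
    also have "\<dots> = (\<Sum>c\<in>C. \<Sum>d\<in>C. \<Sum>e\<in>C. \<Sum>f\<in>C. w c d * (?L c e * G l e f * ?R f d))"
      by (intro sum.cong refl) (simp only: split sum_distrib_left)
    also have "\<dots> = (\<Sum>e\<in>C. \<Sum>f\<in>C. \<Sum>c\<in>C. \<Sum>d\<in>C. w c d * (?L c e * G l e f * ?R f d))"
      by (rule sum_swap4[symmetric])
    also have "\<dots> = (\<Sum>e\<in>C. \<Sum>f\<in>C. env (\<beta> l) (\<beta> (Suc l)) e f * G l e f)"
      unfolding env_def sum_distrib_right by (intro sum.cong refl) (simp add: mult_ac)
    finally have h: "h {l} = \<dots>" .
    show ?thesis
    proof (cases "y l")
      case True
      have "F True l = kprod C (base(l := Ker l \<alpha>)) (\<beta> l) (\<beta> (Suc l))"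
        unfolding F_def using cut_block(4)[of l n y] l True
        by (auto intro!: kprod_cong simp: mixed_def \<beta>_def)
      then show ?thesis unfolding h using True by (simp add: G_def cost_def F_def)
    next
      case False
      then have "F True l = F False l" using cut_Suc_eq[of y l n] by (simp add: F_def \<beta>_def)
      then show ?thesis unfolding h using False by (simp add: G_def)
    qed
  qed
  have "h {..<n} \<le> exp 2 * (\<Sum>l<n. h {l})"
  proof -
    let ?A = "(\<lambda>l. {l}) ` {..<n}"
    have cut_paste: "P S \<omega> * P T \<omega> = P {} \<omega> * P (S \<union> T) \<omega>" if "S \<inter> T = {}" for S T \<omega>
    proof -
      have "(\<Prod>l<n. F (l \<in> S) l (\<omega> l) (\<omega> (Suc l)) * F (l \<in> T) l (\<omega> l) (\<omega> (Suc l)))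
        = (\<Prod>l<n. F (l \<in> {}) l (\<omega> l) (\<omega> (Suc l)) * F (l \<in> S \<union> T) l (\<omega> l) (\<omega> (Suc l)))"
      proof (intro prod.cong refl)
        fix l
        show "F (l \<in> S) l (\<omega> l) (\<omega> (Suc l)) * F (l \<in> T) l (\<omega> l) (\<omega> (Suc l))
          = F (l \<in> {}) l (\<omega> l) (\<omega> (Suc l)) * F (l \<in> S \<union> T) l (\<omega> l) (\<omega> (Suc l))"
          using that by (cases "l \<in> S"; cases "l \<in> T") auto
      qed
      then show ?thesis unfolding P_def prod.distrib by simp
    qed
    have "h (\<Union>?A) \<le> exp (2 - 2 / real (card ?A)) * sum h ?A"
      unfolding h_def using i0
      by (intro hellinger_union_le fin\<Omega> P_nonneg P_norm cut_paste) (auto simp: disjoint_def)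
    also have "\<dots> \<le> exp 2 * sum h ?A"
      by (intro mult_right_mono) (auto simp: h_def intro!: sum_nonneg)
    also have "sum h ?A = (\<Sum>l<n. h {l})"
      by (subst sum.reindex) (auto simp: inj_on_def)
    finally show ?thesis by (simp only: UN_singleton)
  qed
  then have h_le: "h {..<n} \<le> exp 2 * (\<Sum>i<n. of_bool (y i) * cost \<alpha> i (cut n y i) (cut n y (Suc i)))"
    by (simp add: single \<beta>_def)
  let ?a = "\<lambda>\<omega>. P {} \<omega>" and ?b = "\<lambda>\<omega>. P {..<n} \<omega>"
  have "\<bar>total q (mixed \<alpha> y) - total q base\<bar> = \<bar>\<Sum>\<omega>\<in>\<Omega>. q (\<omega> 0) (\<omega> n) * (?b \<omega> - ?a \<omega>)\<bar>"
    using tot[of True] tot[of False] by (simp add: right_diff_distrib sum_subtractf)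
  also have "\<dots> \<le> (\<Sum>\<omega>\<in>\<Omega>. \<bar>q (\<omega> 0) (\<omega> n) * (?b \<omega> - ?a \<omega>)\<bar>)" by (rule sum_abs)
  \<comment> \<open>A weighted arithmetic-geometric mean inequality in place of Cauchy-Schwarz keeps
    the bound linear in the squared distance. The weights are chosen so that the second summand
    totals 2 / 8.\<close>
  also have "\<dots> \<le> (\<Sum>\<omega>\<in>\<Omega>. 4 * (sqrt (?a \<omega>) - sqrt (?b \<omega>))\<^sup>2 + (?a \<omega> + ?b \<omega>) / 8)"
  proof (intro sum_mono)
    fix \<omega>
    define r s where "r = sqrt (?a \<omega>)" and "s = sqrt (?b \<omega>)"
    have rs: "?a \<omega> = r\<^sup>2" "?b \<omega> = s\<^sup>2" "r \<ge> 0" "s \<ge> 0" using P_nonneg by (auto simp: r_def s_def)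
    have "\<bar>q (\<omega> 0) (\<omega> n) * (s\<^sup>2 - r\<^sup>2)\<bar> \<le> 1 * \<bar>s\<^sup>2 - r\<^sup>2\<bar>"
      unfolding abs_mult using q by (intro mult_right_mono) auto
    also have "\<bar>s\<^sup>2 - r\<^sup>2\<bar> = \<bar>r - s\<bar> * (r + s)"
      using rs by (simp add: power2_eq_square square_diff_square_factored abs_mult abs_minus_commute mult.commute add.commute)
    also have "\<dots> \<le> 4 * (r - s)\<^sup>2 + (r + s)\<^sup>2 / 16"
      using zero_le_power2[of "2 * \<bar>r - s\<bar> - (r + s) / 4"] by (simp add: power2_diff power_mult_distrib power_divide)
    also have "(r + s)\<^sup>2 / 16 \<le> (r\<^sup>2 + s\<^sup>2) / 8"
      using zero_le_power2[of "r - s"] by (simp add: power2_diff power2_sum)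
    finally show "\<bar>q (\<omega> 0) (\<omega> n) * (?b \<omega> - ?a \<omega>)\<bar>
       \<le> 4 * (sqrt (?a \<omega>) - sqrt (?b \<omega>))\<^sup>2 + (?a \<omega> + ?b \<omega>) / 8"
      using rs by (simp add: r_def[symmetric] s_def[symmetric])
  qed
  also have "\<dots> = 4 * h {..<n} + 1 / 4"
    using P_norm[of "{}"] P_norm[of "{..<n}"]
    by (simp add: sum.distrib h_def sum_distrib_left add_divide_distrib sum_divide_distrib[symmetric])
  finally show ?thesis using h_le by simp
qed

text \<open>The product is linear in its factor at \<open>i\<close>, and \<open>base i\<close> is
  the average of \<open>Ker i \<alpha>\<close>.\<close>

lemma average_single:
  assumes "i < n"
  shows "(\<Sum>\<alpha><t. 1 / real t * total q (base(i := Ker i \<alpha>))) = total q base"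
proof -
  have k: "(\<Sum>\<alpha><t. 1 / real t * kprod C (base(i := Ker i \<alpha>)) 0 n c d) = kprod C base 0 n c d"
    if cd: "c \<in> C" "d \<in> C" for c d
  proof -
    have upd: "kprod C (base(i := Ker i \<alpha>)) 0 i = kprod C base 0 i"
      "kprod C (base(i := Ker i \<alpha>)) (Suc i) n = kprod C base (Suc i) n" for \<alpha>
      by (auto intro!: kprod_cong)
    let ?L = "kprod C base 0 i" and ?R = "kprod C base (Suc i) n"
    have "(\<Sum>\<alpha><t. 1 / real t * kprod C (base(i := Ker i \<alpha>)) 0 n c d)
      = (\<Sum>\<alpha><t. \<Sum>e\<in>C. \<Sum>f\<in>C. ?L c e * (1 / real t * Ker i \<alpha> e f) * ?R f d)"
      unfolding kprod_split_at[OF finite_C le0 assms cd, of "base(i := Ker i _)"] upd sum_distrib_left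
      by (intro sum.cong refl) (simp add: mult_ac)
    also have "\<dots> = (\<Sum>e\<in>C. \<Sum>f\<in>C. \<Sum>\<alpha><t. ?L c e * (1 / real t * Ker i \<alpha> e f) * ?R f d)"
      by (subst sum.swap, rule sum.cong[OF refl], rule sum.swap)
    also have "\<dots> = (\<Sum>e\<in>C. \<Sum>f\<in>C. ?L c e * base i e f * ?R f d)"
      by (simp only: base_def sum_distrib_left sum_distrib_right)
    also have "\<dots> = kprod C base 0 n c d"
      by (rule kprod_split_at[OF finite_C le0 assms cd, symmetric])
    finally show ?thesis .
  qed
  have "(\<Sum>\<alpha><t. 1 / real t * total q (base(i := Ker i \<alpha>)))
    = (\<Sum>\<alpha><t. \<Sum>c\<in>C. \<Sum>d\<in>C. w c d * q c d * (1 / real t * kprod C (base(i := Ker i \<alpha>)) 0 n c d))"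
    unfolding total_def sum_distrib_left by (intro sum.cong refl) (simp add: mult_ac)
  also have "\<dots> = (\<Sum>c\<in>C. \<Sum>d\<in>C. \<Sum>\<alpha><t. w c d * q c d * (1 / real t * kprod C (base(i := Ker i \<alpha>)) 0 n c d))"
    by (subst sum.swap, rule sum.cong[OF refl], rule sum.swap)
  also have "\<dots> = total q base"
    unfolding total_def sum_distrib_left[symmetric] by (intro sum.cong refl) (simp only: k[unfolded sum_distrib_left[symmetric]])
  finally show ?thesis .
qed

lemma average_not_several:
  assumes "\<not> several n y"
  shows "(\<Sum>\<alpha><t. 1 / real t * total q (mixed \<alpha> y)) = total q base"
proof (cases "\<exists>i<n. y i")
  case True
  then obtain i where i: "i < n" "y i" by auto
  have "\<not> y j" if "j < n" "j \<noteq> i" for j using assms i that by (auto simp: several_def)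
  then have "kprod C (mixed \<alpha> y) 0 n = kprod C (base(i := Ker i \<alpha>)) 0 n" for \<alpha>
    using i by (intro kprod_cong) (auto simp: mixed_def)
  then have "total q (mixed \<alpha> y) = total q (base(i := Ker i \<alpha>))" for \<alpha>
    by (simp add: total_def)
  then show ?thesis using average_single[OF i(1)] by simp
next
  case False
  then have "kprod C (mixed \<alpha> y) 0 n = kprod C base 0 n" for \<alpha>
    by (intro kprod_cong) (auto simp: mixed_def)
  then show ?thesis using t_pos by (simp add: total_def)
qed

text \<open>For each fixed \<open>y\<close> the average over \<alpha> is taken before the absolute
  value: with a single needle only this average vanishes, not the difference for each \<alpha>. The
  cuts depend on \<open>y\<close> alone, so they do not interfere. The constant 32 is 4 from
  \<open>mixed_distance\<close> times 8 from \<open>expected_block_cost\<close>.\<close>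

lemma needle_distance:
  assumes p: "0 < p" "p \<le> 1" and q: "\<And>c d. 0 \<le> q c d" "\<And>c d. q c d \<le> 1"
  shows "\<bar>(\<Sum>\<alpha><t. 1 / real t * total q (\<lambda>i c d. p * Ker i \<alpha> c d + (1 - p) * base i c d)) - total q base\<bar>
    \<le> 1 / 4 + 32 * exp 2 * (p\<^sup>2 * real n * ln (real (card C)))"
proof -
  let ?b = "bernoulli_weight n p"
  define cst where "cst \<alpha> y = (\<Sum>i<n. of_bool (y i) * cost \<alpha> i (cut n y i) (cut n y (Suc i)))" for \<alpha> y
  have b_nonneg: "?b y \<ge> 0" for y using p by (intro prod_nonneg) auto
  have exp_mix: "total q (\<lambda>i c d. p * Ker i \<alpha> c d + (1 - p) * base i c d)
      = (\<Sum>y\<in>bool_vectors n. ?b y * total q (mixed \<alpha> y))" for \<alpha>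
  proof -
    have eq: "(\<lambda>i c d. p * Ker i \<alpha> c d + (1 - p) * base i c d)
      = (\<lambda>i c d. \<Sum>b\<in>UNIV. (if b then p else 1 - p) * (if b then Ker i \<alpha> else base i) c d)"
      by (intro ext) (simp add: UNIV_bool)
    have kp: "kprod C (\<lambda>i c d. p * Ker i \<alpha> c d + (1 - p) * base i c d) 0 n c d
      = (\<Sum>y\<in>bool_vectors n. ?b y * kprod C (mixed \<alpha> y) 0 n c d)" for c d
      unfolding mixed_def[abs_def] eq
      by (rule kprod_multilinear[of UNIV C "\<lambda>i b. if b then p else 1 - p"
            "\<lambda>i b. if b then Ker i \<alpha> else base i" 0 n c d, OF finite])
    have "w c d * q c d * (\<Sum>y\<in>bool_vectors n. ?b y * kprod C (mixed \<alpha> y) 0 n c d)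
       = (\<Sum>y\<in>bool_vectors n. ?b y * (w c d * q c d * kprod C (mixed \<alpha> y) 0 n c d))" for c d
      unfolding sum_distrib_left by (intro sum.cong refl) (rule mult.left_commute)
    then have "total q (\<lambda>i c d. p * Ker i \<alpha> c d + (1 - p) * base i c d)
       = (\<Sum>c\<in>C. \<Sum>d\<in>C. \<Sum>y\<in>bool_vectors n. ?b y * (w c d * q c d * kprod C (mixed \<alpha> y) 0 n c d))"
      by (simp only: total_def kp)
    also have "\<dots> = (\<Sum>c\<in>C. \<Sum>y\<in>bool_vectors n. \<Sum>d\<in>C. ?b y * (w c d * q c d * kprod C (mixed \<alpha> y) 0 n c d))"
      by (rule sum.cong[OF refl], rule sum.swap)
    also have "\<dots> = (\<Sum>y\<in>bool_vectors n. \<Sum>c\<in>C. \<Sum>d\<in>C. ?b y * (w c d * q c d * kprod C (mixed \<alpha> y) 0 n c d))"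
      by (rule sum.swap)
    finally show ?thesis by (simp only: total_def sum_distrib_left)
  qed
  define \<Delta> where "\<Delta> y = (\<Sum>\<alpha><t. 1 / real t * total q (mixed \<alpha> y)) - total q base" for y
  have \<Delta>: "\<bar>\<Delta> y\<bar> \<le> of_bool (several n y) * (1 / 4 + 4 * exp 2 * (\<Sum>\<alpha><t. 1 / real t * cst \<alpha> y))" for y
  proof (cases "several n y")
    case True
    then obtain i where i: "i < n" "y i" by (auto simp: several_def)
    have "\<Delta> y = (\<Sum>\<alpha><t. 1 / real t * (total q (mixed \<alpha> y) - total q base))"
      using t_pos by (simp add: \<Delta>_def right_diff_distrib sum_subtractf)
    then have "\<bar>\<Delta> y\<bar> \<le> (\<Sum>\<alpha><t. \<bar>1 / real t * (total q (mixed \<alpha> y) - total q base)\<bar>)"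
      by (simp only: sum_abs)
    also have "\<dots> \<le> (\<Sum>\<alpha><t. 1 / real t * (1 / 4 + 4 * exp 2 * cst \<alpha> y))"
      unfolding cst_def abs_mult by (intro sum_mono mult_mono mixed_distance[where ?i0.0 = i] i q) auto
    also have "\<dots> = (\<Sum>\<alpha><t. 1 / real t * (1 / 4)) + (\<Sum>\<alpha><t. 4 * exp 2 * (1 / real t * cst \<alpha> y))"
      unfolding sum.distrib[symmetric] by (intro sum.cong refl) (simp add: algebra_simps)
    also have "\<dots> = 1 / 4 + 4 * exp 2 * (\<Sum>\<alpha><t. 1 / real t * cst \<alpha> y)"
      unfolding sum_distrib_left[symmetric] using t_pos by simp
    finally show ?thesis using True by simp
  next
    case False
    then show ?thesis using average_not_several[OF False, of q] by (simp add: \<Delta>_def)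
  qed
  have avg_cst: "(\<Sum>\<alpha><t. 1 / real t * cst \<alpha> y)
      = (\<Sum>i<n. of_bool (y i) * (\<Sum>\<alpha><t. 1 / real t * cost \<alpha> i (cut n y i) (cut n y (Suc i))))" for y
  proof -
    have "(\<Sum>\<alpha><t. 1 / real t * cst \<alpha> y)
      = (\<Sum>i<n. \<Sum>\<alpha><t. 1 / real t * (of_bool (y i) * cost \<alpha> i (cut n y i) (cut n y (Suc i))))"
      unfolding cst_def sum_distrib_left by (rule sum.swap)
    then show ?thesis by (simp add: sum_distrib_left mult.left_commute)
  qed
  have blocks: "(\<Sum>y\<in>bool_vectors n. ?b y * (of_bool (several n y) * (\<Sum>\<alpha><t. 1 / real t * cst \<alpha> y)))
      \<le> 8 * p\<^sup>2 * real n * ln (real (card C))"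
    unfolding avg_cst
  proof (rule expected_block_cost[OF p])
    show "(\<Sum>\<alpha><t. 1 / real t * cost \<alpha> i a b) \<ge> 0" for i a b
      by (intro sum_nonneg mult_nonneg_nonneg cost_nonneg) auto
  qed (rule expected_cost_le)
  have diff: "(\<Sum>\<alpha><t. 1 / real t * total q (\<lambda>i c d. p * Ker i \<alpha> c d + (1 - p) * base i c d)) - total q base
     = (\<Sum>y\<in>bool_vectors n. ?b y * \<Delta> y)"
  proof -
    have "(\<Sum>\<alpha><t. 1 / real t * total q (\<lambda>i c d. p * Ker i \<alpha> c d + (1 - p) * base i c d))
       = (\<Sum>y\<in>bool_vectors n. \<Sum>\<alpha><t. ?b y * (1 / real t * total q (mixed \<alpha> y)))"
      unfolding exp_mix sum_distrib_left
      by (rule trans[OF sum.swap], intro sum.cong refl, rule mult.left_commute)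
    moreover have "(\<Sum>y\<in>bool_vectors n. ?b y * total q base) = total q base"
      by (simp add: sum_distrib_right[symmetric] sum_bernoulli_weight)
    moreover have "(\<Sum>y\<in>bool_vectors n. ?b y * \<Delta> y)
       = (\<Sum>y\<in>bool_vectors n. \<Sum>\<alpha><t. ?b y * (1 / real t * total q (mixed \<alpha> y)))
         - (\<Sum>y\<in>bool_vectors n. ?b y * total q base)"
      by (simp only: \<Delta>_def right_diff_distrib sum_subtractf sum_distrib_left)
    ultimately show ?thesis by linarith
  qed
  have "\<bar>\<Sum>y\<in>bool_vectors n. ?b y * \<Delta> y\<bar> \<le> (\<Sum>y\<in>bool_vectors n. \<bar>?b y * \<Delta> y\<bar>)" by (rule sum_abs)
  also have "\<dots> \<le> (\<Sum>y\<in>bool_vectors n. ?b y * (1 / 4 + of_bool (several n y) * (4 * exp 2 * (\<Sum>\<alpha><t. 1 / real t * cst \<alpha> y))))"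
  proof (intro sum_mono)
    fix y
    have "\<bar>\<Delta> y\<bar> \<le> 1 / 4 + of_bool (several n y) * (4 * exp 2 * (\<Sum>\<alpha><t. 1 / real t * cst \<alpha> y))"
      using \<Delta>[of y] by (cases "several n y") auto
    then show "\<bar>?b y * \<Delta> y\<bar> \<le> ?b y * (1 / 4 + of_bool (several n y) * (4 * exp 2 * (\<Sum>\<alpha><t. 1 / real t * cst \<alpha> y)))"
      unfolding abs_mult abs_of_nonneg[OF b_nonneg] by (rule mult_left_mono[OF _ b_nonneg])
  qed
  also have "\<dots> = (\<Sum>y\<in>bool_vectors n. ?b y) * (1 / 4)
      + 4 * exp 2 * (\<Sum>y\<in>bool_vectors n. ?b y * (of_bool (several n y) * (\<Sum>\<alpha><t. 1 / real t * cst \<alpha> y)))"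
  proof -
    have "?b y * (1 / 4 + of_bool (several n y) * (4 * exp 2 * z)) = ?b y * (1 / 4) + 4 * exp 2 * (?b y * (of_bool (several n y) * z))"
      for y z by (simp add: distrib_left mult_ac)
    then have "(\<Sum>y\<in>bool_vectors n. ?b y * (1 / 4 + of_bool (several n y) * (4 * exp 2 * (\<Sum>\<alpha><t. 1 / real t * cst \<alpha> y))))
      = (\<Sum>y\<in>bool_vectors n. ?b y * (1 / 4) + 4 * exp 2 * (?b y * (of_bool (several n y) * (\<Sum>\<alpha><t. 1 / real t * cst \<alpha> y))))"
      by (rule sum.cong[OF refl])
    also have "\<dots> = (\<Sum>y\<in>bool_vectors n. ?b y * (1 / 4))
      + (\<Sum>y\<in>bool_vectors n. 4 * exp 2 * (?b y * (of_bool (several n y) * (\<Sum>\<alpha><t. 1 / real t * cst \<alpha> y))))"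
      by (rule sum.distrib)
    finally show ?thesis
      by (simp only: sum_distrib_left[symmetric, of "4 * exp 2"] sum_distrib_right[symmetric])
  qed
  also have "\<dots> \<le> 1 / 4 + 4 * exp 2 * (8 * p\<^sup>2 * real n * ln (real (card C)))"
    using mult_left_mono[OF blocks, of "4 * exp 2"] by (simp only: sum_bernoulli_weight) simp
  finally show ?thesis unfolding diff by (simp only: mult_ac)
qed

end

section \<open>Multi-pass algorithms\<close>

text \<open>A column collects the memory contents of all \<open>k\<close> passes at one position of the stream. It turns the
  \<open>k\<close> passes over \<open>s\<close> bits into a single pass over \<open>k * s\<close> bits.\<close>

definition columns :: "nat \<Rightarrow> nat \<Rightarrow> (nat \<Rightarrow> nat) set" where
  "columns k s = PiE {..<k} (\<lambda>_. {..<2 ^ s})"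

definition stochastic :: "nat \<Rightarrow> (nat \<Rightarrow> nat \<Rightarrow> real) \<Rightarrow> bool" where
  "stochastic s D \<longleftrightarrow> (\<forall>u v. 0 \<le> D u v) \<and> (\<forall>u<2 ^ s. (\<Sum>v<2 ^ s. D u v) = 1)"

text \<open>The Kronecker product of one matrix per pass: the passes act independently of each
  other.\<close>

definition tensor :: "nat \<Rightarrow> (nat \<Rightarrow> nat \<Rightarrow> nat \<Rightarrow> real) \<Rightarrow> (nat \<Rightarrow> nat) \<Rightarrow> (nat \<Rightarrow> nat) \<Rightarrow> real" where
  "tensor k D c d = (\<Prod>j<k. D j (c j) (d j))"

text \<open>Being stochastic on columns would be too weak for \<open>mixture_norm\<close>. With two
  passes, a matrix could make the end of the first pass depend on the start of the second, which
  \<open>wrap\<close> equates with it; the circular constraint may then have no solution or several.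
  Tensor products exclude this. Averaging over a symbol, which all passes read, correlates the
  passes, so affine combinations are needed as well; they preserve normalization by linearity. Only
  entries at genuine columns matter, hence \<open>mixture_cong\<close>.\<close>

inductive mixture :: "nat \<Rightarrow> nat \<Rightarrow> ((nat \<Rightarrow> nat) \<Rightarrow> (nat \<Rightarrow> nat) \<Rightarrow> real) \<Rightarrow> bool" for k s where
  mixture_tensor: "(\<And>j. j < k \<Longrightarrow> stochastic s (D j)) \<Longrightarrow> mixture k s (tensor k D)"
| mixture_affine: "finite X \<Longrightarrow> sum \<rho> X = 1 \<Longrightarrow> (\<And>x. x \<in> X \<Longrightarrow> mixture k s (K x))
    \<Longrightarrow> mixture k s (\<lambda>c d. \<Sum>x\<in>(X :: nat set). \<rho> x * K x c d)"
| mixture_cong: "mixture k s A \<Longrightarrow> (\<And>c d. c \<in> columns k s \<Longrightarrow> d \<in> columns k s \<Longrightarrow> A c d = B c d)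
    \<Longrightarrow> mixture k s B"

lemma finite_columns: "finite (columns k s)"
  unfolding columns_def by (intro finite_PiE) auto

lemma columns_nonempty: "columns k s \<noteq> {}"
proof -
  have "(\<lambda>j\<in>{..<k}. 0) \<in> columns k s" by (auto simp: columns_def)
  then show ?thesis by blast
qed

lemma card_columns: "card (columns k s) = 2 ^ (k * s)"
  by (simp add: columns_def card_PiE power_mult[symmetric] mult.commute)

lemma columns_less: "c \<in> columns k s \<Longrightarrow> j < k \<Longrightarrow> c j < 2 ^ s"
  by (auto simp: columns_def)

lemma sum_columns_prod:
  "(\<Sum>e\<in>columns k s. \<Prod>j<k. g j (e j)) = (\<Prod>j<k. \<Sum>v<2 ^ s. g j v :: real)"
  unfolding columns_def by (subst prod_sum_PiE) auto

text \<open>The mixed-product property of Kronecker products.\<close>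

lemma tensor_mult:
  "(\<Sum>e\<in>columns k s. tensor k D c e * tensor k D' e d)
    = tensor k (\<lambda>j u v. \<Sum>x<2 ^ s. D j u x * D' j x v) c d"
  unfolding tensor_def prod.distrib[symmetric] by (rule sum_columns_prod)

lemma stochastic_mult:
  assumes "stochastic s D" "stochastic s D'"
  shows "stochastic s (\<lambda>u v. \<Sum>x<2 ^ s. D u x * D' x v)"
  unfolding stochastic_def
proof (intro conjI allI impI)
  show "0 \<le> (\<Sum>x<2 ^ s. D u x * D' x v)" for u v
    using assms by (intro sum_nonneg) (auto simp: stochastic_def)
  fix u :: nat assume u: "u < 2 ^ s"
  have "(\<Sum>v<2 ^ s. \<Sum>x<2 ^ s. D u x * D' x v) = (\<Sum>x<2 ^ s. \<Sum>v<2 ^ s. D u x * D' x v)"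
    by (rule sum.swap)
  also have "\<dots> = (\<Sum>x<2 ^ s. D u x * (\<Sum>v<2 ^ s. D' x v))" by (simp only: sum_distrib_left)
  also have "\<dots> = (\<Sum>x<2 ^ s. D u x)" using assms(2) by (simp add: stochastic_def)
  finally show "(\<Sum>v<2 ^ s. \<Sum>x<2 ^ s. D u x * D' x v) = 1"
    using assms(1) u by (simp add: stochastic_def)
qed

text \<open>Multiplication is bilinear, so closure reduces to products of two tensors. This treats
  the right factor, \<open>mixture_mult\<close> the left one.\<close>

lemma mixture_mult_tensor:
  assumes "\<And>j. j < k \<Longrightarrow> stochastic s (D j)" "mixture k s B"
  shows "mixture k s (\<lambda>c d. \<Sum>e\<in>columns k s. tensor k D c e * B e d)"
  using assms(2)
proof induction
  case (mixture_tensor D')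
  have "mixture k s (tensor k (\<lambda>j u v. \<Sum>x<2 ^ s. D j u x * D' j x v))"
    using assms(1) mixture_tensor by (intro mixture.mixture_tensor stochastic_mult)
  then show ?case by (rule mixture_cong) (simp only: tensor_mult)
next
  case (mixture_affine X \<rho> K)
  have "mixture k s (\<lambda>c d. \<Sum>x\<in>X. \<rho> x * (\<Sum>e\<in>columns k s. tensor k D c e * K x e d))"
    using mixture_affine by (intro mixture.mixture_affine)
  moreover have "(\<Sum>x\<in>X. \<rho> x * (\<Sum>e\<in>columns k s. tensor k D c e * K x e d))
     = (\<Sum>e\<in>columns k s. tensor k D c e * (\<Sum>x\<in>X. \<rho> x * K x e d))" for c d
    unfolding sum_distrib_left
    by (rule trans[OF sum.swap], intro sum.cong refl, rule mult.left_commute)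
  ultimately show ?case by simp
next
  case (mixture_cong A B)
  show ?case
    by (rule mixture.mixture_cong[OF mixture_cong.IH]) (simp add: mixture_cong.hyps(2))
qed

lemma mixture_mult:
  assumes "mixture k s A" "mixture k s B"
  shows "mixture k s (\<lambda>c d. \<Sum>e\<in>columns k s. A c e * B e d)"
  using assms(1)
proof induction
  case (mixture_tensor D)
  then show ?case using assms(2) by (intro mixture_mult_tensor)
next
  case (mixture_affine X \<rho> K)
  have "mixture k s (\<lambda>c d. \<Sum>x\<in>X. \<rho> x * (\<Sum>e\<in>columns k s. K x c e * B e d))"
    using mixture_affine by (intro mixture.mixture_affine)
  moreover have "(\<Sum>x\<in>X. \<rho> x * (\<Sum>e\<in>columns k s. K x c e * B e d))
     = (\<Sum>e\<in>columns k s. (\<Sum>x\<in>X. \<rho> x * K x c e) * B e d)" for c d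
    unfolding sum_distrib_left sum_distrib_right
    by (rule trans[OF sum.swap], intro sum.cong refl, rule mult.assoc[symmetric])
  ultimately show ?case by simp
next
  case (mixture_cong A A')
  show ?case
    by (rule mixture.mixture_cong[OF mixture_cong.IH]) (simp add: mixture_cong.hyps(2))
qed

text \<open>The memory in which pass \<open>j\<close> starts is the one in which pass \<open>j - 1\<close> ended; for
  \<open>j = k\<close> it is the final memory.\<close>

definition start :: "nat \<Rightarrow> (nat \<Rightarrow> nat) \<Rightarrow> nat \<Rightarrow> nat" where
  "start \<sigma>0 d j = (case j of 0 \<Rightarrow> \<sigma>0 | Suc j' \<Rightarrow> d j')"

definition wrap :: "nat \<Rightarrow> nat \<Rightarrow> (nat \<Rightarrow> nat) \<Rightarrow> (nat \<Rightarrow> nat) \<Rightarrow> real" where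
  "wrap k \<sigma>0 c d = (\<Prod>j<k. of_bool (c j = start \<sigma>0 d j))"

lemma start_less:
  assumes "\<sigma>0 < 2 ^ s" "d \<in> columns k s" "j \<le> k"
  shows "start \<sigma>0 d j < 2 ^ s"
  using assms columns_less[OF assms(2)] by (cases j) (auto simp: start_def)

lemma sum_wrap_tensor:
  assumes "\<sigma>0 < 2 ^ s"
  shows "(\<Sum>c\<in>columns k s. \<Sum>d\<in>columns k s. wrap k \<sigma>0 c d * g d * tensor k D c d)
    = (\<Sum>d\<in>columns k s. g d * (\<Prod>j<k. D j (start \<sigma>0 d j) (d j)))"
proof -
  have "(\<Sum>c\<in>columns k s. wrap k \<sigma>0 c d * g d * tensor k D c d) = g d * (\<Prod>j<k. D j (start \<sigma>0 d j) (d j))"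
    if d: "d \<in> columns k s" for d
  proof -
    have "(\<Sum>c\<in>columns k s. wrap k \<sigma>0 c d * g d * tensor k D c d)
      = g d * (\<Sum>c\<in>columns k s. \<Prod>j<k. of_bool (c j = start \<sigma>0 d j) * D j (c j) (d j))"
      unfolding wrap_def tensor_def prod.distrib sum_distrib_left by (intro sum.cong refl) simp
    also have "(\<Sum>c\<in>columns k s. \<Prod>j<k. of_bool (c j = start \<sigma>0 d j) * D j (c j) (d j))
      = (\<Prod>j<k. \<Sum>v<2 ^ s. of_bool (v = start \<sigma>0 d j) * D j v (d j))"
      by (rule sum_columns_prod)
    also have "\<dots> = (\<Prod>j<k. D j (start \<sigma>0 d j) (d j))"
    proof (intro prod.cong refl)
      fix j assume "j \<in> {..<k}"
      then have "start \<sigma>0 d j < 2 ^ s" using start_less[OF assms d, of j] by simp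
      then show "(\<Sum>v<2 ^ s. of_bool (v = start \<sigma>0 d j) * D j v (d j)) = D j (start \<sigma>0 d j) (d j)"
        using sum_of_bool_eq_left[of "{..<2 ^ s}" "start \<sigma>0 d j" "\<lambda>v. D j v (d j)"]
        by (simp add: eq_commute)
    qed
    finally show ?thesis .
  qed
  then show ?thesis by (subst sum.swap) simp
qed

lemma columns_Suc_sum:
  "(\<Sum>d\<in>columns (Suc k) s. g d) = (\<Sum>v<2 ^ s. \<Sum>d\<in>columns k s. g (d(k := v)))"
  unfolding columns_def lessThan_Suc by (rule sum_PiE_insert) simp

lemma start_upd:
  "j \<le> k \<Longrightarrow> start \<sigma>0 (d(k := v)) j = start \<sigma>0 d j"
  "start \<sigma>0 (d(k := v)) (Suc k) = v"
  by (auto simp: start_def split: nat.splits)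

text \<open>The passes form a Markov chain. The end of the last pass occurs in no other factor, so
  that pass can be summed out by its row sum.\<close>

lemma sum_chain:
  assumes "\<sigma>0 < 2 ^ s" "\<And>j. j < k \<Longrightarrow> stochastic s (D j)"
  shows "(\<Sum>d\<in>columns k s. \<Prod>j<k. D j (start \<sigma>0 d j) (d j)) = 1"
  using assms(2)
proof (induction k)
  case 0
  then show ?case by (simp add: columns_def)
next
  case (Suc k)
  have pr: "(\<Prod>j<k. D j (start \<sigma>0 (d(k := v)) j) ((d(k := v)) j)) = (\<Prod>j<k. D j (start \<sigma>0 d j) (d j))" for d v
    by (intro prod.cong refl) (auto simp: start_upd)
  have "(\<Sum>d\<in>columns (Suc k) s. \<Prod>j<Suc k. D j (start \<sigma>0 d j) (d j))
      = (\<Sum>v<2 ^ s. \<Sum>d\<in>columns k s. (\<Prod>j<k. D j (start \<sigma>0 d j) (d j)) * D k (start \<sigma>0 d k) v)"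
    unfolding columns_Suc_sum prod.lessThan_Suc pr by (simp add: start_upd)
  also have "\<dots> = (\<Sum>d\<in>columns k s. \<Sum>v<2 ^ s. (\<Prod>j<k. D j (start \<sigma>0 d j) (d j)) * D k (start \<sigma>0 d k) v)"
    by (rule sum.swap)
  also have "\<dots> = (\<Sum>d\<in>columns k s. (\<Prod>j<k. D j (start \<sigma>0 d j) (d j)) * (\<Sum>v<2 ^ s. D k (start \<sigma>0 d k) v))"
    by (simp only: sum_distrib_left)
  also have "\<dots> = (\<Sum>d\<in>columns k s. (\<Prod>j<k. D j (start \<sigma>0 d j) (d j)) * 1)"
    using Suc.prems[of k] start_less[OF assms(1), of _ k k]
    by (intro sum.cong refl) (auto simp: stochastic_def)
  also have "\<dots> = 1" using Suc by simp
  finally show ?case .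
qed

lemma mixture_norm:
  assumes "\<sigma>0 < 2 ^ s" "mixture k s A"
  shows "(\<Sum>c\<in>columns k s. \<Sum>d\<in>columns k s. wrap k \<sigma>0 c d * A c d) = 1"
  using assms(2)
proof induction
  case (mixture_tensor D)
  have "(\<Sum>c\<in>columns k s. \<Sum>d\<in>columns k s. wrap k \<sigma>0 c d * tensor k D c d)
     = (\<Sum>d\<in>columns k s. \<Prod>j<k. D j (start \<sigma>0 d j) (d j))"
    using sum_wrap_tensor[OF assms(1), of k "\<lambda>_. 1" D] by simp
  then show ?case using sum_chain[OF assms(1), of k D] mixture_tensor by simp
next
  case (mixture_affine X \<rho> K)
  let ?C = "columns k s"
  have "(\<Sum>c\<in>?C. \<Sum>d\<in>?C. wrap k \<sigma>0 c d * (\<Sum>x\<in>X. \<rho> x * K x c d))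
     = (\<Sum>c\<in>?C. \<Sum>d\<in>?C. \<Sum>x\<in>X. \<rho> x * (wrap k \<sigma>0 c d * K x c d))"
    unfolding sum_distrib_left by (intro sum.cong refl) (rule mult.left_commute)
  also have "\<dots> = (\<Sum>c\<in>?C. \<Sum>x\<in>X. \<Sum>d\<in>?C. \<rho> x * (wrap k \<sigma>0 c d * K x c d))"
    by (rule sum.cong[OF refl], rule sum.swap)
  also have "\<dots> = (\<Sum>x\<in>X. \<Sum>c\<in>?C. \<Sum>d\<in>?C. \<rho> x * (wrap k \<sigma>0 c d * K x c d))"
    by (rule sum.swap)
  also have "\<dots> = (\<Sum>x\<in>X. \<rho> x * (\<Sum>c\<in>?C. \<Sum>d\<in>?C. wrap k \<sigma>0 c d * K x c d))"
    by (simp only: sum_distrib_left)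
  also have "\<dots> = 1" using mixture_affine by simp
  finally show ?case .
next
  case (mixture_cong A B)
  have "(\<Sum>c\<in>columns k s. \<Sum>d\<in>columns k s. wrap k \<sigma>0 c d * B c d)
     = (\<Sum>c\<in>columns k s. \<Sum>d\<in>columns k s. wrap k \<sigma>0 c d * A c d)"
    by (intro sum.cong refl) (simp add: mixture_cong.hyps(2))
  then show ?case using mixture_cong.IH by simp
qed

lemma mixture_Id: "mixture k s (\<lambda>c d. of_bool (c = d))"
proof (rule mixture_cong)
  show "mixture k s (tensor k (\<lambda>j u v. of_bool (u = v)))"
  proof (rule mixture_tensor)
    show "stochastic s (\<lambda>u v. of_bool (u = v))"
      unfolding stochastic_def using sum_of_bool_eq_left[of "{..<2 ^ s}" _ "\<lambda>_. 1"] by auto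
  qed
  fix c d assume cd: "c \<in> columns k s" "d \<in> columns k s"
  show "tensor k (\<lambda>j u v. of_bool (u = v)) c d = of_bool (c = d)"
  proof (cases "c = d")
    case False
    then obtain j where "j < k" "c j \<noteq> d j"
      using cd PiE_ext[of c "{..<k}" "\<lambda>_. {..<2 ^ s}" d] by (auto simp: columns_def)
    then have "tensor k (\<lambda>j u v. of_bool (u = v)) c d = 0"
      unfolding tensor_def by (intro prod_zero) auto
    then show ?thesis using False by simp
  qed (simp add: tensor_def)
qed

lemma mixture_uniform: "mixture k s (\<lambda>c d. 1 / real (card (columns k s)))"
proof (rule mixture_cong)
  show "mixture k s (tensor k (\<lambda>j u v. 1 / 2 ^ s))"
    by (rule mixture_tensor) (simp add: stochastic_def)
  show "tensor k (\<lambda>j u v. 1 / 2 ^ s) c d = 1 / real (card (columns k s))" for c d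
    by (simp add: tensor_def card_columns power_one_over power_mult[symmetric] mult.commute)
qed

text \<open>Running all passes in parallel along the stream equals running each pass on its own, by
  the mixed-product property. For the empty product, columns are equal as soon as they agree on all
  passes, since they are extensional.\<close>

lemma kprod_tensor:
  assumes "c \<in> columns k s" "d \<in> columns k s"
  shows "kprod (columns k s) (\<lambda>i. tensor k (\<lambda>j. D j i)) a b c d
    = tensor k (\<lambda>j. kprod {..<2 ^ s} (D j) a b) c d"
  using assms(2)
proof (induction b arbitrary: d)
  case 0
  have "c = d \<longleftrightarrow> (\<forall>j<k. c j = d j)"
    using assms(1) 0 PiE_ext[of c "{..<k}" "\<lambda>_. {..<2 ^ s}" d] by (auto simp: columns_def)
  then show ?case by (auto simp: tensor_def intro!: prod_zero[symmetric])
next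
  case (Suc b)
  show ?case
  proof (cases "a \<le> b")
    case True
    have "kprod (columns k s) (\<lambda>i. tensor k (\<lambda>j. D j i)) a (Suc b) c d
       = (\<Sum>e\<in>columns k s. tensor k (\<lambda>j. kprod {..<2 ^ s} (D j) a b) c e * tensor k (\<lambda>j. D j b) e d)"
      unfolding kprod_Suc[OF True] by (intro sum.cong refl) (simp only: Suc.IH)
    also have "\<dots> = tensor k (\<lambda>j. kprod {..<2 ^ s} (D j) a (Suc b)) c d"
      unfolding tensor_mult using True by simp
    finally show ?thesis .
  next
    case False
    have "c = d \<longleftrightarrow> (\<forall>j<k. c j = d j)"
      using assms(1) Suc.prems PiE_ext[of c "{..<k}" "\<lambda>_. {..<2 ^ s}" d] by (auto simp: columns_def)
    then show ?thesis using False by (auto simp: tensor_def intro!: prod_zero[symmetric])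
  qed
qed

section \<open>Runs of the algorithm on random input as kernel products\<close>

lemma iid_list_Suc_pair:
  "iid_list (Suc m) \<mu> = map_pmf (\<lambda>(x, xs). x # xs) (pair_pmf \<mu> (iid_list m \<mu>))"
  by (simp add: pair_pmf_def map_bind_pmf)

lemma pmf_iid_list:
  assumes "length xs = m"
  shows "pmf (iid_list m \<mu>) xs = (\<Prod>i<m. pmf \<mu> (xs ! i))"
  using assms
proof (induction m arbitrary: xs)
  case 0
  then show ?case by simp
next
  case (Suc m)
  then obtain x ys where xs: "xs = x # ys" "length ys = m" by (auto simp: length_Suc_conv)
  have "inj (\<lambda>(x, xs). x # xs)" by (auto simp: inj_on_def)
  from pmf_map_inj'[OF this, of "pair_pmf \<mu> (iid_list m \<mu>)" "(x, ys)"]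
  have "pmf (iid_list (Suc m) \<mu>) xs = pmf \<mu> x * pmf (iid_list m \<mu>) ys"
    unfolding iid_list_Suc_pair xs(1) by (simp add: pmf_pair)
  then show ?case using Suc.IH[OF xs(2)] unfolding prod.lessThan_Suc_shift by (simp add: xs(1))
qed

lemma set_iid_list:
  assumes "set_pmf \<mu> \<subseteq> X"
  shows "set_pmf (iid_list m \<mu>) \<subseteq> {xs. set xs \<subseteq> X \<and> length xs = m}"
proof (induction m)
  case (Suc m)
  then show ?case using assms by (fastforce simp: subset_iff)
qed simp

lemma pmf_bind_finite:
  assumes "finite A" "set_pmf M \<subseteq> A"
  shows "pmf (bind_pmf M f) x = (\<Sum>a\<in>A. pmf M a * pmf (f a) x)"
  unfolding pmf_bind
  by (subst integral_measure_pmf_real[of A]) (use assms in \<open>auto simp: mult.commute\<close>)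

lemma pmf_bind_iid_list:
  assumes "finite X" "set_pmf \<mu> \<subseteq> X"
  shows "pmf (bind_pmf (iid_list m \<mu>) f) r
    = (\<Sum>y\<in>PiE {0..<m} (\<lambda>_. X). (\<Prod>i\<in>{0..<m}. pmf \<mu> (y i)) * pmf (f (map y [0..<m])) r)"
proof -
  let ?L = "{xs. set xs \<subseteq> X \<and> length xs = m}"
  have "pmf (bind_pmf (iid_list m \<mu>) f) r = (\<Sum>xs\<in>?L. pmf (iid_list m \<mu>) xs * pmf (f xs) r)"
    using assms by (intro pmf_bind_finite finite_lists_length_eq set_iid_list)
  also have "\<dots> = (\<Sum>y\<in>PiE {0..<m} (\<lambda>_. X). (\<Prod>i\<in>{0..<m}. pmf \<mu> (y i)) * pmf (f (map y [0..<m])) r)"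
  proof (rule sum.reindex_bij_witness[of _ "\<lambda>y. map y [0..<m]" "\<lambda>xs. restrict (nth xs) {0..<m}"])
    fix xs assume xs: "xs \<in> ?L"
    show *: "map (restrict (nth xs) {0..<m}) [0..<m] = xs"
      using xs by (intro nth_equalityI) auto
    show "restrict (nth xs) {0..<m} \<in> PiE {0..<m} (\<lambda>_. X)"
      using xs by (auto simp: subset_iff)
    show "(\<Prod>i\<in>{0..<m}. pmf \<mu> (restrict (nth xs) {0..<m} i)) * pmf (f (map (restrict (nth xs) {0..<m}) [0..<m])) r
        = pmf (iid_list m \<mu>) xs * pmf (f xs) r"
      unfolding * using xs by (simp add: pmf_iid_list atLeast0LessThan)
  next
    fix y assume y: "y \<in> PiE {0..<m} (\<lambda>_. X)"
    show "restrict (nth (map y [0..<m])) {0..<m} = y"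
      using y by (intro ext) (auto simp: restrict_def PiE_def extensional_def)
    show "map y [0..<m] \<in> ?L" using y by (auto simp: PiE_def Pi_def)
  qed
  finally show ?thesis .
qed

lemma set_run_pass:
  assumes "uses_s_bits s \<sigma>0 \<delta>" "u < 2 ^ s"
  shows "set_pmf (run_pass \<delta> j i xs u) \<subseteq> {..<2 ^ s}"
  using assms(2)
proof (induction xs arbitrary: i u)
  case (Cons x xs)
  have "set_pmf (\<delta> j i u x) \<subseteq> {..<2 ^ s}" using assms(1) Cons.prems by (auto simp: uses_s_bits_def)
  then show ?case using Cons.IH by (auto simp: subset_iff)
qed simp

lemma set_run_passes:
  assumes "uses_s_bits s \<sigma>0 \<delta>"
  shows "set_pmf (run_passes \<delta> xs m \<sigma>0) \<subseteq> {..<2 ^ s}"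
proof (induction m)
  case 0
  then show ?case using assms by (simp add: uses_s_bits_def)
next
  case (Suc m)
  then show ?case using set_run_pass[OF assms] by (auto simp: subset_iff)
qed

lemma pmf_run_pass:
  assumes "uses_s_bits s \<sigma>0 \<delta>" "i \<le> m" "u < 2 ^ s" "v < 2 ^ s"
  shows "pmf (run_pass \<delta> j i (map y [i..<m]) u) v
    = kprod {..<2 ^ s} (\<lambda>i u v. pmf (\<delta> j i u (y i)) v) i m u v"
  using assms(2,3)
proof (induction i arbitrary: u rule: inc_induct)
  case base
  then show ?case by simp
next
  case (step i)
  let ?K = "\<lambda>i u v. pmf (\<delta> j i u (y i)) v"
  have sup: "set_pmf (\<delta> j i u (y i)) \<subseteq> {..<2 ^ s}"
    using assms(1) step.prems by (auto simp: uses_s_bits_def)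
  have "pmf (run_pass \<delta> j i (map y [i..<m]) u) v
      = (\<Sum>e<2 ^ s. ?K i u e * pmf (run_pass \<delta> j (Suc i) (map y [Suc i..<m]) e) v)"
    using step.hyps by (simp add: upt_conv_Cons pmf_bind_finite[OF _ sup])
  also have "\<dots> = (\<Sum>e<2 ^ s. kprod {..<2 ^ s} ?K i (Suc i) u e * kprod {..<2 ^ s} ?K (Suc i) m e v)"
    using step.IH step.prems by (intro sum.cong refl) (simp add: kprod_single del: kprod.simps)
  also have "\<dots> = kprod {..<2 ^ s} ?K i m u v"
    using step.hyps step.prems assms(4) by (intro kprod_append[symmetric]) auto
  finally show ?case .
qed

lemma pmf_run_passes:
  assumes "uses_s_bits s \<sigma>0 \<delta>" "v < 2 ^ s"
  shows "pmf (run_passes \<delta> xs m \<sigma>0) v = (\<Sum>d\<in>columns m s. of_bool (start \<sigma>0 d m = v) *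
    (\<Prod>j<m. pmf (run_pass \<delta> j 0 xs (start \<sigma>0 d j)) (d j)))"
  using assms(2)
proof (induction m arbitrary: v)
  case 0
  then show ?case by (simp add: columns_def start_def)
next
  case (Suc m)
  define D where "D j u v = pmf (run_pass \<delta> j 0 xs u) v" for j u v
  have \<sigma>0: "\<sigma>0 < 2 ^ s" using assms(1) by (simp add: uses_s_bits_def)
  define ch where "ch d = (\<Prod>j<m. D j (start \<sigma>0 d j) (d j))" for d
  have pr: "(\<Prod>j<m. D j (start \<sigma>0 (d(m := v)) j) ((d(m := v)) j)) = ch d" for d v
    unfolding ch_def by (intro prod.cong refl) (auto simp: start_upd)
  have "pmf (run_passes \<delta> xs (Suc m) \<sigma>0) v = (\<Sum>u<2 ^ s. pmf (run_passes \<delta> xs m \<sigma>0) u * D m u v)"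
    using pmf_bind_finite[OF _ set_run_passes[OF assms(1)]] by (simp add: D_def)
  also have "\<dots> = (\<Sum>u<2 ^ s. \<Sum>d\<in>columns m s. ch d * (of_bool (start \<sigma>0 d m = u) * D m u v))"
    using Suc.IH by (intro sum.cong refl) (simp add: D_def ch_def sum_distrib_left sum_distrib_right mult_ac)
  also have "\<dots> = (\<Sum>d\<in>columns m s. \<Sum>u<2 ^ s. ch d * (of_bool (start \<sigma>0 d m = u) * D m u v))"
    by (rule sum.swap)
  also have "\<dots> = (\<Sum>d\<in>columns m s. ch d * D m (start \<sigma>0 d m) v)"
  proof (intro sum.cong refl)
    fix d assume "d \<in> columns m s"
    then have "start \<sigma>0 d m < 2 ^ s" using start_less[OF \<sigma>0, of d m m] by simp
    then show "(\<Sum>u<2 ^ s. ch d * (of_bool (start \<sigma>0 d m = u) * D m u v)) = ch d * D m (start \<sigma>0 d m) v"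
      unfolding sum_distrib_left[symmetric] by (subst sum_of_bool_eq_left) auto
  qed
  \<comment> \<open>The final memory becomes the new coordinate \<open>m\<close> of a longer column;
    the indicator is the condition on \<open>start \<sigma>0 d (Suc m)\<close>, which reads that
    coordinate.\<close>
  also have "\<dots> = (\<Sum>d\<in>columns m s. \<Sum>v'<2 ^ s. (ch d * D m (start \<sigma>0 d m) v') * of_bool (v' = v))"
    using Suc.prems by (intro sum.cong refl sum_of_bool_eq_right[symmetric]) auto
  also have "\<dots> = (\<Sum>v'<2 ^ s. \<Sum>d\<in>columns m s. (ch d * D m (start \<sigma>0 d m) v') * of_bool (v' = v))"
    by (rule sum.swap)
  also have "\<dots> = (\<Sum>d\<in>columns (Suc m) s. of_bool (start \<sigma>0 d (Suc m) = v) * (\<Prod>j<Suc m. D j (start \<sigma>0 d j) (d j)))"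
    unfolding columns_Suc_sum prod.lessThan_Suc pr
    by (intro sum.cong refl) (simp add: start_upd)
  finally show ?case by (simp add: D_def)
qed

text \<open>A tensor product because, for a given symbol, the passes use independent private
  randomness.\<close>

definition memory_kernel :: "nat \<Rightarrow> (nat \<Rightarrow> nat \<Rightarrow> nat \<Rightarrow> nat \<Rightarrow> nat pmf) \<Rightarrow> nat \<Rightarrow> nat
    \<Rightarrow> (nat \<Rightarrow> nat) \<Rightarrow> (nat \<Rightarrow> nat) \<Rightarrow> real" where
  "memory_kernel k \<delta> i x = tensor k (\<lambda>j u v. pmf (\<delta> j i u x) v)"

lemma pmf_run_alg:
  assumes "uses_s_bits s \<sigma>0 \<delta>"
  shows "pmf (run_alg k \<sigma>0 \<delta> out (map y [0..<m])) r =
    (\<Sum>c\<in>columns k s. \<Sum>d\<in>columns k s. wrap k \<sigma>0 c d * pmf (out (start \<sigma>0 d k)) r *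
       kprod (columns k s) (\<lambda>i. memory_kernel k \<delta> i (y i)) 0 m c d)"
proof -
  define D where "D j = kprod {..<2 ^ s} (\<lambda>i u v. pmf (\<delta> j i u (y i)) v) 0 m" for j
  define ch where "ch d = (\<Prod>j<k. D j (start \<sigma>0 d j) (d j))" for d
  have \<sigma>0: "\<sigma>0 < 2 ^ s" using assms by (simp add: uses_s_bits_def)
  have "(\<Sum>c\<in>columns k s. \<Sum>d\<in>columns k s. wrap k \<sigma>0 c d * pmf (out (start \<sigma>0 d k)) r *
       kprod (columns k s) (\<lambda>i. memory_kernel k \<delta> i (y i)) 0 m c d)
     = (\<Sum>c\<in>columns k s. \<Sum>d\<in>columns k s. wrap k \<sigma>0 c d * pmf (out (start \<sigma>0 d k)) r * tensor k D c d)"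
    unfolding memory_kernel_def D_def[abs_def]
    by (intro sum.cong refl) (simp only: kprod_tensor[of _ _ _ _ "\<lambda>j i u v. pmf (\<delta> j i u (y i)) v"])
  also have "\<dots> = (\<Sum>d\<in>columns k s. pmf (out (start \<sigma>0 d k)) r * ch d)"
    unfolding ch_def by (rule sum_wrap_tensor[OF \<sigma>0])
  also have "\<dots> = (\<Sum>d\<in>columns k s. \<Sum>v<2 ^ s. ch d * (of_bool (start \<sigma>0 d k = v) * pmf (out v) r))"
  proof (intro sum.cong refl)
    fix d assume "d \<in> columns k s"
    then have "start \<sigma>0 d k < 2 ^ s" using start_less[OF \<sigma>0, of d k k] by simp
    then show "pmf (out (start \<sigma>0 d k)) r * ch d = (\<Sum>v<2 ^ s. ch d * (of_bool (start \<sigma>0 d k = v) * pmf (out v) r))"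
      unfolding sum_distrib_left[symmetric] by (subst sum_of_bool_eq_left) auto
  qed
  also have "\<dots> = (\<Sum>v<2 ^ s. \<Sum>d\<in>columns k s. ch d * (of_bool (start \<sigma>0 d k = v) * pmf (out v) r))"
    by (rule sum.swap)
  also have "\<dots> = (\<Sum>v<2 ^ s. pmf (run_passes \<delta> (map y [0..<m]) k \<sigma>0) v * pmf (out v) r)"
  proof (intro sum.cong refl)
    fix v assume v: "v \<in> {..<(2::nat) ^ s}"
    have "pmf (run_passes \<delta> (map y [0..<m]) k \<sigma>0) v = (\<Sum>d\<in>columns k s. of_bool (start \<sigma>0 d k = v) * ch d)"
    proof -
      have "(\<Prod>j<k. pmf (run_pass \<delta> j 0 (map y [0..<m]) (start \<sigma>0 d j)) (d j)) = ch d"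
        if "d \<in> columns k s" for d
        unfolding ch_def D_def using start_less[OF \<sigma>0 that] columns_less[OF that]
        by (intro prod.cong refl pmf_run_pass[OF assms]) auto
      then show ?thesis using v by (simp add: pmf_run_passes[OF assms])
    qed
    then show "(\<Sum>d\<in>columns k s. ch d * (of_bool (start \<sigma>0 d k = v) * pmf (out v) r))
      = pmf (run_passes \<delta> (map y [0..<m]) k \<sigma>0) v * pmf (out v) r"
      by (simp only: sum_distrib_right) (intro sum.cong refl, simp)
  qed
  also have "\<dots> = pmf (run_alg k \<sigma>0 \<delta> out (map y [0..<m])) r"
    unfolding run_alg_def by (rule pmf_bind_finite[OF _ set_run_passes[OF assms], symmetric]) simp
  finally show ?thesis ..
qed

lemma stream_kernels_memory:
  assumes "uses_s_bits s \<sigma>0 \<delta>" "t > 0"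
  shows "stream_kernels (columns k s) (wrap k \<sigma>0) (mixture k s) t (memory_kernel k \<delta>)"
proof
  have stoch: "stochastic s (\<lambda>u v. pmf (\<delta> j i u x) v)" for j i x
    unfolding stochastic_def
  proof (intro conjI allI impI)
    fix u :: nat assume "u < 2 ^ s"
    then have "set_pmf (\<delta> j i u x) \<subseteq> {..<2 ^ s}" using assms(1) by (simp add: uses_s_bits_def)
    then show "(\<Sum>v<2 ^ s. pmf (\<delta> j i u x) v) = 1" by (intro sum_pmf_eq_1) auto
  qed simp
  show "mixture k s (memory_kernel k \<delta> i x)" for i x
    unfolding memory_kernel_def by (intro mixture_tensor stoch)
  show "wrap k \<sigma>0 c d \<ge> 0" for c d unfolding wrap_def by (intro prod_nonneg) auto
  show "memory_kernel k \<delta> i x c d \<ge> 0" for i x c d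
    unfolding memory_kernel_def tensor_def by (intro prod_nonneg) auto
  show "(\<Sum>d\<in>columns k s. memory_kernel k \<delta> i x c d) = 1" if "c \<in> columns k s" for i x c
  proof -
    have "(\<Sum>d\<in>columns k s. memory_kernel k \<delta> i x c d) = (\<Prod>j<k. \<Sum>v<2 ^ s. pmf (\<delta> j i (c j) x) v)"
      unfolding memory_kernel_def tensor_def by (rule sum_columns_prod[where g = "\<lambda>j v. pmf (\<delta> j i (c j) x) v"])
    also have "\<dots> = 1"
      using stoch columns_less[OF that] by (intro prod.neutral) (auto simp: stochastic_def)
    finally show ?thesis .
  qed
  show "mixture k s (\<lambda>c d. \<Sum>e\<in>columns k s. A c e * B e d)"
    if "mixture k s A" "mixture k s B" for A B using that by (rule mixture_mult)
  show "mixture k s (\<lambda>c d. \<Sum>x\<in>X. \<rho> x * K x c d)"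
    if "finite X" "sum \<rho> X = 1" "\<And>x. x \<in> X \<Longrightarrow> mixture k s (K x)" for X :: "nat set" and \<rho> K
    using that by (rule mixture_affine)
  show "(\<Sum>c\<in>columns k s. \<Sum>d\<in>columns k s. wrap k \<sigma>0 c d * A c d) = 1" if "mixture k s A" for A
    using assms(1) that by (intro mixture_norm) (auto simp: uses_s_bits_def)
qed (use assms(2) in \<open>simp_all add: finite_columns columns_nonempty mixture_Id mixture_uniform\<close>)

theorem theorem1p9:
  shows "\<exists>\<epsilon>0::real. \<epsilon>0 > 0 \<and> (\<exists>c::real. c > 0 \<and>
    (\<forall>(t::nat) (n::nat) (p::real) (k::nat) (s::nat) (\<sigma>0::nat)
        (\<delta>::nat \<Rightarrow> nat \<Rightarrow> nat \<Rightarrow> nat \<Rightarrow> nat pmf) (out::nat \<Rightarrow> bool pmf).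
      t > 0 \<longrightarrow> real n \<le> real t / 100 \<longrightarrow> 0 < p \<longrightarrow> p \<le> 1 \<longrightarrow>
      uses_s_bits s \<sigma>0 \<delta> \<longrightarrow>
      measure_pmf.prob (bind_pmf (D0 t n) (run_alg k \<sigma>0 \<delta> out)) {True}
        + measure_pmf.prob (bind_pmf (D1 t n p) (run_alg k \<sigma>0 \<delta> out)) {False} \<le> \<epsilon>0 \<longrightarrow>
      real k * real s * p ^ 2 * real n \<ge> c))"
proof (rule exI[of _ "1 / 2"], rule conjI, simp, rule exI[of _ "1 / (128 * exp 2)"], intro conjI allI impI)
  \<comment> \<open>An error of at most 1/2 means an advantage of at least 1/2, of which
    \<open>needle_distance\<close> absorbs 1/4. The other 1/4 is at most \<open>32 * exp 2\<close>
    times the quantity to be bounded, and 4 * 32 = 128.\<close>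
  fix t n :: nat and p :: real and k s \<sigma>0 :: nat
    and \<delta> :: "nat \<Rightarrow> nat \<Rightarrow> nat \<Rightarrow> nat \<Rightarrow> nat pmf" and out :: "nat \<Rightarrow> bool pmf"
  assume t: "t > 0" and p: "0 < p" "p \<le> 1" and bits: "uses_s_bits s \<sigma>0 \<delta>"
    and err: "measure_pmf.prob (bind_pmf (D0 t n) (run_alg k \<sigma>0 \<delta> out)) {True}
        + measure_pmf.prob (bind_pmf (D1 t n p) (run_alg k \<sigma>0 \<delta> out)) {False} \<le> 1 / 2"
  interpret stream_kernels "columns k s" "wrap k \<sigma>0" "mixture k s" n t "memory_kernel k \<delta>"
    using bits t by (rule stream_kernels_memory)
  define q where "q c d = pmf (out (start \<sigma>0 d k)) True" for c d :: "nat \<Rightarrow> nat"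
  define \<nu> where "\<nu> \<alpha> = bind_pmf (bernoulli_pmf p) (\<lambda>b. if b then return_pmf \<alpha> else unif t)" for \<alpha>
  have set_unif: "set_pmf (unif t) = {..<t}"
    using t by (simp add: unif_def set_pmf_of_set atLeast0LessThan lessThan_empty_iff)
  have pmf_unif: "pmf (unif t) x = 1 / real t" if "x < t" for x
    using t that by (simp add: unif_def)
  have pmf_\<nu>: "pmf (\<nu> \<alpha>) x = p * of_bool (x = \<alpha>) + (1 - p) * (1 / real t)" if "x < t" for \<alpha> x
  proof -
    have "pmf (\<nu> \<alpha>) x = pmf (return_pmf \<alpha>) x * p + pmf (unif t) x * (1 - p)"
      unfolding \<nu>_def pmf_bind using p by simp
    moreover have "pmf (return_pmf \<alpha>) x = of_bool (x = \<alpha>)" by (simp add: pmf_return indicator_def)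
    ultimately show ?thesis by (simp only: pmf_unif[OF that] mult.commute)
  qed
  have set_\<nu>: "set_pmf (\<nu> \<alpha>) \<subseteq> {..<t}" if "\<alpha> < t" for \<alpha>
  proof
    fix x assume "x \<in> set_pmf (\<nu> \<alpha>)"
    then obtain b where "x \<in> set_pmf (if b then return_pmf \<alpha> else unif t)"
      unfolding \<nu>_def set_bind_pmf by blast
    then show "x \<in> {..<t}" using that set_unif by (cases b) simp_all
  qed
  \<comment> \<open>Both inputs are i.i.d., the needle input once \<alpha> is fixed. So averaging
    the run over the input amounts to averaging the kernel at each position separately.\<close>
  have link: "pmf (bind_pmf (iid_list n \<mu>) (run_alg k \<sigma>0 \<delta> out)) True
      = total q (\<lambda>i c d. \<Sum>x<t. pmf \<mu> x * memory_kernel k \<delta> i x c d)"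
    if \<mu>: "set_pmf \<mu> \<subseteq> {..<t}" for \<mu>
  proof -
    let ?C = "columns k s" and ?Y = "PiE {0..<n} (\<lambda>_. {..<t})"
    let ?g = "\<lambda>y c d. (\<Prod>i\<in>{0..<n}. pmf \<mu> (y i)) *
      (wrap k \<sigma>0 c d * q c d * kprod ?C (\<lambda>i. memory_kernel k \<delta> i (y i)) 0 n c d)"
    have "pmf (bind_pmf (iid_list n \<mu>) (run_alg k \<sigma>0 \<delta> out)) True = (\<Sum>y\<in>?Y. \<Sum>c\<in>?C. \<Sum>d\<in>?C. ?g y c d)"
      unfolding pmf_bind_iid_list[OF finite_lessThan \<mu>] pmf_run_alg[OF bits] sum_distrib_left q_def ..
    also have "\<dots> = (\<Sum>c\<in>?C. \<Sum>y\<in>?Y. \<Sum>d\<in>?C. ?g y c d)"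
      by (rule sum.swap)
    also have "\<dots> = (\<Sum>c\<in>?C. \<Sum>d\<in>?C. \<Sum>y\<in>?Y. ?g y c d)"
      by (rule sum.cong[OF refl], rule sum.swap)
    also have "\<dots> = total q (\<lambda>i c d. \<Sum>x<t. pmf \<mu> x * memory_kernel k \<delta> i x c d)"
      unfolding total_def kprod_multilinear[OF finite_lessThan] sum_distrib_left
      by (intro sum.cong refl) (rule mult.left_commute)
    finally show ?thesis .
  qed
  have a: "pmf (bind_pmf (D0 t n) (run_alg k \<sigma>0 \<delta> out)) True = total q base"
  proof -
    have "(\<lambda>i c d. \<Sum>x<t. pmf (unif t) x * memory_kernel k \<delta> i x c d) = base"
      by (intro ext) (simp add: base_def pmf_unif)
    then show ?thesis unfolding D0_def using link[of "unif t"] set_unif by simp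
  qed
  have b: "pmf (bind_pmf (D1 t n p) (run_alg k \<sigma>0 \<delta> out)) True
      = (\<Sum>\<alpha><t. 1 / real t * total q (\<lambda>i c d. p * memory_kernel k \<delta> i \<alpha> c d + (1 - p) * base i c d))"
  proof -
    have mix: "(\<lambda>i c d. \<Sum>x<t. pmf (\<nu> \<alpha>) x * memory_kernel k \<delta> i x c d)
        = (\<lambda>i c d. p * memory_kernel k \<delta> i \<alpha> c d + (1 - p) * base i c d)" if "\<alpha> < t" for \<alpha>
    proof (intro ext)
      fix i c d
      let ?K = "\<lambda>x. memory_kernel k \<delta> i x c d"
      have "(\<Sum>x<t. pmf (\<nu> \<alpha>) x * ?K x) = (\<Sum>x<t. p * (?K x * of_bool (x = \<alpha>)) + (1 - p) * (1 / real t * ?K x))"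
        by (intro sum.cong refl) (simp add: pmf_\<nu> algebra_simps)
      also have "\<dots> = p * (\<Sum>x<t. ?K x * of_bool (x = \<alpha>)) + (1 - p) * (\<Sum>x<t. 1 / real t * ?K x)"
        by (simp only: sum.distrib sum_distrib_left)
      finally show "(\<Sum>x<t. pmf (\<nu> \<alpha>) x * ?K x) = p * ?K \<alpha> + (1 - p) * base i c d"
        using that by (simp only: base_def sum_of_bool_eq_right[of "{..<t}" \<alpha> ?K] finite_lessThan lessThan_iff)
    qed
    have "pmf (bind_pmf (D1 t n p) (run_alg k \<sigma>0 \<delta> out)) True
      = (\<Sum>\<alpha><t. pmf (unif t) \<alpha> * pmf (bind_pmf (iid_list n (\<nu> \<alpha>)) (run_alg k \<sigma>0 \<delta> out)) True)"
      unfolding D1_def bind_assoc_pmf \<nu>_def[symmetric] using set_unif by (intro pmf_bind_finite) auto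
    also have "\<dots> = (\<Sum>\<alpha><t. 1 / real t * total q (\<lambda>i c d. p * memory_kernel k \<delta> i \<alpha> c d + (1 - p) * base i c d))"
      by (intro sum.cong refl) (simp add: pmf_unif link[OF set_\<nu>] mix)
    finally show ?thesis .
  qed
  let ?A = "pmf (bind_pmf (D0 t n) (run_alg k \<sigma>0 \<delta> out)) True"
  let ?B = "pmf (bind_pmf (D1 t n p) (run_alg k \<sigma>0 \<delta> out)) True"
  have "\<bar>?B - ?A\<bar> \<le> 1 / 4 + 32 * exp 2 * (p\<^sup>2 * real n * ln (real (card (columns k s))))"
    unfolding a b by (rule needle_distance[OF p]) (simp_all add: q_def pmf_le_1)
  moreover have "?A + (1 - ?B) \<le> 1 / 2"
    using err by (simp add: measure_pmf_single pmf_False_conv_True)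
  ultimately have "1 / 4 \<le> 32 * exp 2 * (p\<^sup>2 * real n * ln (real (card (columns k s))))" by linarith
  also have "\<dots> \<le> 32 * exp 2 * (p\<^sup>2 * real n * (real k * real s))"
  proof (intro mult_left_mono)
    have "ln (real (card (columns k s))) = real (k * s) * ln 2"
      by (simp add: card_columns ln_realpow)
    also have "\<dots> \<le> real (k * s) * 1" using ln_le_minus_one[of 2] by (intro mult_left_mono) auto
    finally show "ln (real (card (columns k s))) \<le> real k * real s" by simp
  qed auto
  finally show "1 / (128 * exp 2) \<le> real k * real s * p ^ 2 * real n"
    by (simp add: field_simps)
qed auto

end
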